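(* Let $(h,\ast,1)$ be an associative presheaf. Then the maps $\Delta$ and $\epsilon$ defined on the basis by $\Delta\mathrm{p}_a=\sum_{b,c\in\mathcal G(h),\,b\cdot c=a}\mathrm{p}_b\otimes\mathrm{p}_c$ and $\epsilon(\mathrm{p}_a)=1$ if $a$ is the class of $1$ and $0$ otherwise give $\mathcal A(h)$ the structure of a coalgebra, and together with the pointwise multiplication of functions this makes $\mathcal A(h)$ a bialgebra. Furthermore, if $h$ is connected, i.e. $|h[\emptyset]|=1$, then $\mathcal A(h)$ is a Hopf algebra.
   Context: A combinatorial presheaf $h$ is a contravariant functor from finite sets with injections to finite sets; $h[I]$ is the set of objects on $I$, $a|_J$ is restriction of $a\in h[I]$ to $J\subseteq I$, $|a|=|I|$. Objects $a\in h[I],b\in h[J]$ are isomorphic ($a\sim b$) if a bijection $f:I\to J$ has $h[f](b)=a$. $\mathcal G(h)=\biguplus_{n\ge0}h[[n]]/\sim$. For objects $a$ and $b\in h[I]$, $\mathrm{p}_a(b)=|\{J'\subseteq I:b|_{J'}\sim a\}|$, a function on $\mathcal G(h)$; $\mathcal A(h)$ is the $\mathbb Q$-span of the $\mathrm{p}_a$, $a\in\mathcal G(h)$, an algebra under pointwise multiplication (the $\mathrm{p}_a$ form a basis). An associative presheaf $(h,\ast,1)$ is a presheaf $h$ with maps $h[I]\times h[J]\to h[I\sqcup J]$, $(a,b)\mapsto a\ast b$, for disjoint $I,J$, natural in relabelings, such that $(a\ast b)|_{A\sqcup B}=a|_A\ast b|_B$ for $A\subseteq I,B\subseteq J$, $(a\ast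 b)\ast c=a\ast(b\ast c)$, and $a\ast1=1\ast a=a$ for a unit $1\in h[\emptyset]$. This induces an associative product on $\mathcal G(h)$: for $a\in h[[n_1]]$, $b\in h[[n_2]]$, the class $\bar a\cdot\bar b$ is the class of $a\ast b'$ where $b'$ is $b$ relabeled to $\{n_1+1,\dots,n_1+n_2\}$ by the order preserving bijection. *)

theory Defs
  imports Complex_Main "HOL-Library.Function_Algebras" "HOL-Library.Indicator_Function"
begin

section \<open>Spaces of functions and their tensor products\<close>

definition fscale :: "'k::field \<Rightarrow> ('x \<Rightarrow> 'k) \<Rightarrow> 'x \<Rightarrow> 'k" where
  "fscale c f = (\<lambda>x. c * f x)"

interpretation fun_space: vector_space "fscale :: 'k::field \<Rightarrow> ('x \<Rightarrow> 'k) \<Rightarrow> 'x \<Rightarrow> 'k"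
  by unfold_locales (auto simp: fscale_def fun_eq_iff algebra_simps)

definition linear_on ::
  "('x \<Rightarrow> 'k::field) set \<Rightarrow> ('k \<Rightarrow> 'c::ab_group_add \<Rightarrow> 'c) \<Rightarrow> (('x \<Rightarrow> 'k) \<Rightarrow> 'c) \<Rightarrow> bool" where
  "linear_on V s L \<longleftrightarrow>
     (\<forall>f\<in>V. \<forall>g\<in>V. L (f + g) = L f + L g) \<and> (\<forall>c. \<forall>f\<in>V. L (fscale c f) = s c (L f))"

definition bilinear_on ::
  "('x \<Rightarrow> 'k::field) set \<Rightarrow> ('y \<Rightarrow> 'k) set \<Rightarrow> ('k \<Rightarrow> 'c::ab_group_add \<Rightarrow> 'c)
     \<Rightarrow> (('x \<Rightarrow> 'k) \<Rightarrow> ('y \<Rightarrow> 'k) \<Rightarrow> 'c) \<Rightarrow> bool" where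
  "bilinear_on V W s \<beta> \<longleftrightarrow>
     (\<forall>g\<in>W. linear_on V s (\<lambda>f. \<beta> f g)) \<and> (\<forall>f\<in>V. linear_on W s (\<beta> f))"

text \<open>
  For subspaces \<open>V\<close> of \<open>'x \<Rightarrow> 'k\<close> and \<open>W\<close> of \<open>'y \<Rightarrow> 'k\<close> the tensor product is realised inside
  \<open>'x \<times> 'y \<Rightarrow> 'k\<close>. Theorem \<open>tensor_universal\<close> below shows that this space, with \<open>tens\<close>, has the
  universal property of the tensor product of \<open>V\<close> and \<open>W\<close> over the field \<open>'k\<close>.
\<close>

definition tens :: "('x \<Rightarrow> 'k::field) \<Rightarrow> ('y \<Rightarrow> 'k) \<Rightarrow> 'x \<times> 'y \<Rightarrow> 'k" (infixr \<open>\<otimes>\<^sub>f\<close> 72) where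
  "f \<otimes>\<^sub>f g = (\<lambda>(x, y). f x * g y)"

definition tensor :: "('x \<Rightarrow> 'k::field) set \<Rightarrow> ('y \<Rightarrow> 'k) set \<Rightarrow> ('x \<times> 'y \<Rightarrow> 'k) set" where
  "tensor V W = fun_space.span {f \<otimes>\<^sub>f g | f g. f \<in> V \<and> g \<in> W}"

lemma bilinear_tens: "bilinear_on V W fscale (\<otimes>\<^sub>f)"
  by (auto simp: bilinear_on_def linear_on_def tens_def fscale_def fun_eq_iff algebra_simps)

lemma sum_fun_apply: "(\<Sum>i\<in>I. F i) x = (\<Sum>i\<in>I. F i x)"
  for F :: "'i \<Rightarrow> 'x \<Rightarrow> 'c::comm_monoid_add"
  by (induction I rule: infinite_finite_induct) auto

lemma independent_tens:
  fixes B :: "('x \<Rightarrow> 'k::field) set" and D :: "('y \<Rightarrow> 'k) set"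
  assumes B: "fun_space.independent B" and D: "fun_space.independent D"
  shows "inj_on (\<lambda>(b, d). b \<otimes>\<^sub>f d) (B \<times> D)"
    and "fun_space.independent ((\<lambda>(b, d). b \<otimes>\<^sub>f d) ` (B \<times> D))"
proof -
  have key: "c (b, d) = 0"
    if fin: "finite S" "finite T" and sub: "S \<subseteq> B" "T \<subseteq> D"
      and z: "(\<Sum>p\<in>S \<times> T. fscale (c p) (fst p \<otimes>\<^sub>f snd p)) = 0" and bd: "b \<in> S" "d \<in> T"
    for S T b d and c :: "('x \<Rightarrow> 'k) \<times> ('y \<Rightarrow> 'k) \<Rightarrow> 'k"
  proof -
    have "(\<Sum>d\<in>T. c (b, d) * d y) = 0" for y
    proof -
      have "(\<Sum>b\<in>S. fscale (\<Sum>d\<in>T. c (b, d) * d y) b) = 0"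
      proof
        fix x
        have "(\<Sum>b\<in>S. fscale (\<Sum>d\<in>T. c (b, d) * d y) b) x
            = (\<Sum>p\<in>S \<times> T. fscale (c p) (fst p \<otimes>\<^sub>f snd p)) (x, y)"
          by (simp add: sum_fun_apply fscale_def tens_def sum_distrib_left sum_distrib_right
              sum.cartesian_product case_prod_unfold mult_ac)
        then show "(\<Sum>b\<in>S. fscale (\<Sum>d\<in>T. c (b, d) * d y) b) x = 0 x"
          using z by simp
      qed
      then show ?thesis
        using fun_space.independentD[OF B fin(1) sub(1) _ bd(1), of "\<lambda>b. \<Sum>d\<in>T. c (b, d) * d y"]
        by simp
    qed
    then have "(\<Sum>d\<in>T. fscale (c (b, d)) d) = 0"
      by (auto simp: fun_eq_iff sum_fun_apply fscale_def)
    then show ?thesis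
      using fun_space.independentD[OF D fin(2) sub(2) _ bd(2), of "\<lambda>d. c (b, d)"] by simp
  qed
  show inj: "inj_on (\<lambda>(b, d). b \<otimes>\<^sub>f d) (B \<times> D)"
  proof (rule inj_onI, rule ccontr)
    fix p q assume pq: "p \<in> B \<times> D" "q \<in> B \<times> D"
      and eq: "(case p of (b, d) \<Rightarrow> b \<otimes>\<^sub>f d) = (case q of (b, d) \<Rightarrow> b \<otimes>\<^sub>f d)" and ne: "p \<noteq> q"
    define c :: "_ \<Rightarrow> 'k" where "c r = (if r = p then 1 else if r = q then -1 else 0)" for r
    let ?S = "{fst p, fst q}" and ?T = "{snd p, snd q}"
    have "(\<Sum>r\<in>?S \<times> ?T. fscale (c r) (fst r \<otimes>\<^sub>f snd r))
        = (\<Sum>r\<in>{p, q}. fscale (c r) (fst r \<otimes>\<^sub>f snd r))"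
      by (rule sum.mono_neutral_right) (auto simp: c_def fscale_def fun_eq_iff mem_Times_iff)
    also have "\<dots> = 0"
      using ne eq by (auto simp: c_def fscale_def fun_eq_iff case_prod_unfold)
    finally have "c (fst p, snd p) = 0"
      using pq by (intro key[of ?S ?T]) (auto simp: mem_Times_iff)
    then show False by (simp add: c_def)
  qed
  show "fun_space.independent ((\<lambda>(b, d). b \<otimes>\<^sub>f d) ` (B \<times> D))"
    unfolding fun_space.independent_explicit_finite_subsets
  proof (intro allI impI ballI)
    fix E u v
    assume E: "E \<subseteq> (\<lambda>(b, d). b \<otimes>\<^sub>f d) ` (B \<times> D)" "finite E"
      and z: "(\<Sum>v\<in>E. fscale (u v) v) = 0" and v: "v \<in> E"
    obtain P where P: "P \<subseteq> B \<times> D" "finite P" "E = (\<lambda>(b, d). b \<otimes>\<^sub>f d) ` P"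
      using E finite_subset_image by metis
    define c where "c r = (if r \<in> P then u (fst r \<otimes>\<^sub>f snd r) else 0)" for r
    obtain p where p: "p \<in> P" "v = fst p \<otimes>\<^sub>f snd p"
      using v P by auto
    have "(\<Sum>r\<in>fst ` P \<times> snd ` P. fscale (c r) (fst r \<otimes>\<^sub>f snd r))
        = (\<Sum>r\<in>P. fscale (c r) (fst r \<otimes>\<^sub>f snd r))"
      using P by (intro sum.mono_neutral_right)
        (auto simp: c_def fscale_def fun_eq_iff mem_Times_iff intro: rev_image_eqI)
    also have "\<dots> = (\<Sum>v\<in>E. fscale (u v) v)"
      unfolding P(3) using inj_on_subset[OF inj P(1)]
      by (subst sum.reindex) (auto simp: c_def case_prod_unfold intro!: sum.cong)
    finally have "c (fst p, snd p) = 0"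
      using P p z by (intro key[of "fst ` P" "snd ` P"]) (auto simp: mem_Times_iff)
    then show "u v = 0" using p by (simp add: c_def)
  qed
qed

theorem tensor_universal:
  fixes V :: "('x \<Rightarrow> 'k::field) set" and W :: "('y \<Rightarrow> 'k) set"
    and s :: "'k \<Rightarrow> 'c::ab_group_add \<Rightarrow> 'c"
  assumes s: "vector_space s"
    and V: "fun_space.subspace V" and W: "fun_space.subspace W"
    and \<beta>: "bilinear_on V W s \<beta>"
  shows "\<exists>L. linear_on (tensor V W) s L \<and> (\<forall>f\<in>V. \<forall>g\<in>W. L (f \<otimes>\<^sub>f g) = \<beta> f g)"
    and "\<lbrakk>linear_on (tensor V W) s L; \<forall>f\<in>V. \<forall>g\<in>W. L (f \<otimes>\<^sub>f g) = \<beta> f g;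
          linear_on (tensor V W) s L'; \<forall>f\<in>V. \<forall>g\<in>W. L' (f \<otimes>\<^sub>f g) = \<beta> f g; t \<in> tensor V W\<rbrakk>
         \<Longrightarrow> L t = L' t"
proof -
  interpret s: vector_space s by (rule s)
  interpret vector_space_pair "fscale :: 'k \<Rightarrow> ('x \<times> 'y \<Rightarrow> 'k) \<Rightarrow> _" s by unfold_locales
  obtain B where B: "B \<subseteq> V" "fun_space.independent B" "V \<subseteq> fun_space.span B"
    using fun_space.maximal_independent_subset by metis
  obtain D where D: "D \<subseteq> W" "fun_space.independent D" "W \<subseteq> fun_space.span D"
    using fun_space.maximal_independent_subset by metis
  let ?t = "\<lambda>(b, d). b \<otimes>\<^sub>f d :: 'x \<times> 'y \<Rightarrow> 'k"
  define L where "L = construct (?t ` (B \<times> D)) (\<lambda>e. (\<lambda>(b, d). \<beta> b d) (inv_into (B \<times> D) ?t e))"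
  have lin: "Vector_Spaces.linear fscale s L"
    unfolding L_def using independent_tens[OF B(2) D(2)] by (intro linear_construct) auto
  have LB: "L (b \<otimes>\<^sub>f d) = \<beta> b d" if "b \<in> B" "d \<in> D" for b d
  proof -
    have "L (?t (b, d)) = (\<lambda>(b, d). \<beta> b d) (inv_into (B \<times> D) ?t (?t (b, d)))"
      unfolding L_def using independent_tens[OF B(2) D(2)] that
      by (intro construct_basis) auto
    also have "inv_into (B \<times> D) ?t (?t (b, d)) = (b, d)"
      using independent_tens(1)[OF B(2) D(2)] that by (intro inv_into_f_f) auto
    finally show ?thesis by simp
  qed
  have \<beta>a: "\<beta> (f + f') g = \<beta> f g + \<beta> f' g" "\<beta> (fscale c f) g = s c (\<beta> f g)"
    if "f \<in> V" "f' \<in> V" "g \<in> W" for f f' g c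
    using \<beta> that by (auto simp: bilinear_on_def linear_on_def)
  have \<beta>b: "\<beta> f (g + g') = \<beta> f g + \<beta> f g'" "\<beta> f (fscale c g) = s c (\<beta> f g)"
    if "f \<in> V" "g \<in> W" "g' \<in> W" for f g g' c
    using \<beta> that by (auto simp: bilinear_on_def linear_on_def)
  have ta: "(f + f') \<otimes>\<^sub>f g = f \<otimes>\<^sub>f g + f' \<otimes>\<^sub>f g" "fscale c f \<otimes>\<^sub>f g = fscale c (f \<otimes>\<^sub>f g)"
    "g \<otimes>\<^sub>f (k + k') = g \<otimes>\<^sub>f k + g \<otimes>\<^sub>f k'" "g \<otimes>\<^sub>f fscale c k = fscale c (g \<otimes>\<^sub>f k)"
    for f f' :: "'u \<Rightarrow> 'k" and g :: "'v \<Rightarrow> 'k" and c and k k' :: "'u \<Rightarrow> 'k"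
    by (auto simp: tens_def fscale_def fun_eq_iff algebra_simps)
  have Ladd: "L (x + y) = L x + L y" and Lsc: "L (fscale c x) = s c (L x)" for x y c
    using linear_add[OF lin] linear_scale[OF lin] by auto
  have V0: "0 \<in> V" and W0: "0 \<in> W"
    using V W by (auto simp: fun_space.subspace_def)
  have sc0: "fscale 0 f = 0" for f :: "'u \<Rightarrow> 'k" by (auto simp: fscale_def)
  have \<beta>0: "\<beta> 0 g = 0" if "g \<in> W" for g
    using \<beta>a(2)[OF V0 V0 that, of 0] by (simp add: sc0)
  have \<beta>0': "\<beta> f 0 = 0" if "f \<in> V" for f
    using \<beta>b(2)[OF that W0 W0, of 0] by (simp add: sc0)
  have L0: "L 0 = 0" using Lsc[of 0 0] by (simp add: sc0)
  have L1: "L (f \<otimes>\<^sub>f d) = \<beta> f d" if "f \<in> V" and d: "d \<in> D" for f d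
  proof -
    have "f \<in> V \<and> L (f \<otimes>\<^sub>f d) = \<beta> f d"
      using subsetD[OF B(3) that(1)]
    proof (induction rule: fun_space.span_induct_alt)
      case base
      have "(0 :: 'x \<Rightarrow> 'k) \<otimes>\<^sub>f d = 0" by (auto simp: tens_def)
      then show ?case using V0 \<beta>0[OF subsetD[OF D(1) d]] L0 by (simp add: zero_fun_def)
    next
      case (step c b f)
      then have "b \<in> V" "f \<in> V" "fscale c b \<in> V" "d \<in> W"
        using B D d V by (auto simp: fun_space.subspace_def)
      moreover from this have "fscale c b + f \<in> V" using V by (auto simp: fun_space.subspace_def)
      ultimately have "fscale c b + f \<in> V \<and> L ((fscale c b + f) \<otimes>\<^sub>f d) = \<beta> (fscale c b + f) d"
        using step LB d by (simp add: ta Ladd Lsc \<beta>a)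
      then show ?case by (simp add: plus_fun_def)
    qed
    then show ?thesis ..
  qed
  have L2: "L (f \<otimes>\<^sub>f g) = \<beta> f g" if f: "f \<in> V" and "g \<in> W" for f g
  proof -
    have "g \<in> W \<and> L (f \<otimes>\<^sub>f g) = \<beta> f g"
      using subsetD[OF D(3) that(2)]
    proof (induction rule: fun_space.span_induct_alt)
      case base
      have "f \<otimes>\<^sub>f (0 :: 'y \<Rightarrow> 'k) = 0" by (auto simp: tens_def)
      then show ?case using W0 \<beta>0'[OF f] L0 by (simp add: zero_fun_def)
    next
      case (step c d g)
      then have "d \<in> W" "g \<in> W" "fscale c d \<in> W"
        using D W by (auto simp: fun_space.subspace_def)
      moreover from this have "fscale c d + g \<in> W" using W by (auto simp: fun_space.subspace_def)
      ultimately have "fscale c d + g \<in> W \<and> L (f \<otimes>\<^sub>f (fscale c d + g)) = \<beta> f (fscale c d + g)"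
        using step L1 f by (simp add: ta Ladd Lsc \<beta>b)
      then show ?case by (simp add: plus_fun_def)
    qed
    then show ?thesis ..
  qed
  show "\<exists>L. linear_on (tensor V W) s L \<and> (\<forall>f\<in>V. \<forall>g\<in>W. L (f \<otimes>\<^sub>f g) = \<beta> f g)"
    using Ladd Lsc L2 by (intro exI[of _ L]) (auto simp: linear_on_def)
next
  assume L: "linear_on (tensor V W) s L" "\<forall>f\<in>V. \<forall>g\<in>W. L (f \<otimes>\<^sub>f g) = \<beta> f g"
    and L': "linear_on (tensor V W) s L'" "\<forall>f\<in>V. \<forall>g\<in>W. L' (f \<otimes>\<^sub>f g) = \<beta> f g"
    and t: "t \<in> tensor V W"
  interpret s: vector_space s by (rule s)
  let ?P = "{f \<otimes>\<^sub>f g | f g. f \<in> V \<and> g \<in> W} :: ('x \<times> 'y \<Rightarrow> 'k) set"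
  have z: "M 0 = 0" if "linear_on (tensor V W) s M" for M
  proof -
    have "(0 :: 'x \<times> 'y \<Rightarrow> 'k) \<in> tensor V W" by (simp add: tensor_def fun_space.span_zero)
    then have "M (0 + 0) = M 0 + M 0" using that unfolding linear_on_def by blast
    then show ?thesis by simp
  qed
  have "t \<in> fun_space.span ?P" using t by (simp add: tensor_def)
  then have "t \<in> tensor V W \<and> L t = L' t"
  proof (induction rule: fun_space.span_induct_alt)
    case base
    have "0 \<in> tensor V W \<and> L 0 = L' 0"
      using z[OF L(1)] z[OF L'(1)] by (simp add: tensor_def fun_space.span_zero)
    then show ?case by (simp add: zero_fun_def)
  next
    case (step c b u)
    have b: "b \<in> tensor V W" using step(1) by (auto simp: tensor_def intro: fun_space.span_base)
    then have cb: "fscale c b \<in> tensor V W" by (simp add: tensor_def fun_space.span_scale)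
    then have "fscale c b + u \<in> tensor V W"
      using step(2) by (simp add: tensor_def fun_space.span_add)
    moreover have "L b = L' b" using step(1) L L' by auto
    ultimately have "fscale c b + u \<in> tensor V W \<and> L (fscale c b + u) = L' (fscale c b + u)"
      using step(2) b cb L(1) L'(1) by (simp add: linear_on_def)
    then show ?case by (simp add: plus_fun_def)
  qed
  then show "L t = L' t" ..
qed

text \<open>The linear map on \<open>tensor V W\<close> induced by a bilinear map \<open>\<beta>\<close>; its values off
  \<open>tensor V W\<close> are irrelevant.\<close>

definition tensor_lift ::
  "('x \<Rightarrow> 'k::field) set \<Rightarrow> ('y \<Rightarrow> 'k) set \<Rightarrow> (('x \<Rightarrow> 'k) \<Rightarrow> ('y \<Rightarrow> 'k) \<Rightarrow> ('z \<Rightarrow> 'k))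
     \<Rightarrow> ('x \<times> 'y \<Rightarrow> 'k) \<Rightarrow> ('z \<Rightarrow> 'k)" where
  "tensor_lift V W \<beta> =
     (SOME L. linear_on (tensor V W) fscale L \<and> (\<forall>f\<in>V. \<forall>g\<in>W. L (f \<otimes>\<^sub>f g) = \<beta> f g))"

lemma tensor_lift:
  assumes "fun_space.subspace V" "fun_space.subspace W" "bilinear_on V W fscale \<beta>"
  shows "linear_on (tensor V W) fscale (tensor_lift V W \<beta>)"
    and "\<lbrakk>f \<in> V; g \<in> W\<rbrakk> \<Longrightarrow> tensor_lift V W \<beta> (f \<otimes>\<^sub>f g) = \<beta> f g"
  using someI_ex[OF tensor_universal(1)[OF fun_space.vector_space_axioms assms]]
  unfolding tensor_lift_def by blast+

definition tensor_map ::
  "('x \<Rightarrow> 'k::field) set \<Rightarrow> ('y \<Rightarrow> 'k) set \<Rightarrow> (('x \<Rightarrow> 'k) \<Rightarrow> ('u \<Rightarrow> 'k)) \<Rightarrow> (('y \<Rightarrow> 'k) \<Rightarrow> ('v \<Rightarrow> 'k))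
     \<Rightarrow> ('x \<times> 'y \<Rightarrow> 'k) \<Rightarrow> ('u \<times> 'v \<Rightarrow> 'k)" where
  "tensor_map V W F G = tensor_lift V W (\<lambda>f g. F f \<otimes>\<^sub>f G g)"

definition tensor_assoc :: "(('x \<times> 'y) \<times> 'z \<Rightarrow> 'k) \<Rightarrow> ('x \<times> ('y \<times> 'z) \<Rightarrow> 'k)" where
  "tensor_assoc t = (\<lambda>(x, (y, z)). t ((x, y), z))"

lemma tensor_assoc_tens: "tensor_assoc ((f \<otimes>\<^sub>f g) \<otimes>\<^sub>f k) = f \<otimes>\<^sub>f (g \<otimes>\<^sub>f k)"
  by (auto simp: tensor_assoc_def tens_def fun_eq_iff mult.assoc)


section \<open>Coalgebras, bialgebras and Hopf algebras\<close>

definition unital_algebra ::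
  "('x \<Rightarrow> 'k::field) set \<Rightarrow> (('x \<Rightarrow> 'k) \<Rightarrow> ('x \<Rightarrow> 'k) \<Rightarrow> ('x \<Rightarrow> 'k)) \<Rightarrow> ('x \<Rightarrow> 'k) \<Rightarrow> bool" where
  "unital_algebra A m u \<longleftrightarrow>
     fun_space.subspace A \<and> bilinear_on A A fscale m \<and> (\<forall>f\<in>A. \<forall>g\<in>A. m f g \<in> A) \<and>
     (\<forall>f\<in>A. \<forall>g\<in>A. \<forall>k\<in>A. m (m f g) k = m f (m g k)) \<and>
     u \<in> A \<and> (\<forall>f\<in>A. m u f = f \<and> m f u = f)"

text \<open>The counit laws use the identifications of \<open>'k \<otimes> C\<close> and \<open>C \<otimes> 'k\<close> with \<open>C\<close>: the map
  \<open>\<epsilon> \<otimes> id\<close> sends \<open>f \<otimes>\<^sub>f g\<close> to \<open>fscale (\<epsilon> f) g\<close>.\<close>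

definition coalgebra ::
  "('x \<Rightarrow> 'k::field) set \<Rightarrow> (('x \<Rightarrow> 'k) \<Rightarrow> ('x \<times> 'x \<Rightarrow> 'k)) \<Rightarrow> (('x \<Rightarrow> 'k) \<Rightarrow> 'k) \<Rightarrow> bool" where
  "coalgebra C \<Delta> \<epsilon> \<longleftrightarrow>
     fun_space.subspace C \<and>
     linear_on C fscale \<Delta> \<and> (\<forall>f\<in>C. \<Delta> f \<in> tensor C C) \<and>
     linear_on C (*) \<epsilon> \<and>
     (\<forall>f\<in>C. tensor_assoc (tensor_map C C \<Delta> id (\<Delta> f)) = tensor_map C C id \<Delta> (\<Delta> f)) \<and>
     (\<forall>f\<in>C. tensor_lift C C (\<lambda>g k. fscale (\<epsilon> g) k) (\<Delta> f) = f) \<and>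
     (\<forall>f\<in>C. tensor_lift C C (\<lambda>g k. fscale (\<epsilon> k) g) (\<Delta> f) = f)"

text \<open>The product of the algebra \<open>A \<otimes> A\<close>, determined by
  \<open>(f \<otimes>\<^sub>f g) (f' \<otimes>\<^sub>f g') = m f f' \<otimes>\<^sub>f m g g'\<close>.\<close>

definition tensor_mult ::
  "('x \<Rightarrow> 'k::field) set \<Rightarrow> (('x \<Rightarrow> 'k) \<Rightarrow> ('x \<Rightarrow> 'k) \<Rightarrow> ('x \<Rightarrow> 'k))
     \<Rightarrow> ('x \<times> 'x \<Rightarrow> 'k) \<Rightarrow> ('x \<times> 'x \<Rightarrow> 'k) \<Rightarrow> ('x \<times> 'x \<Rightarrow> 'k)" where
  "tensor_mult A m t t' =
     tensor_lift A A (\<lambda>f g. tensor_lift A A (\<lambda>f' g'. m f f' \<otimes>\<^sub>f m g g') t') t"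

definition bialgebra ::
  "('x \<Rightarrow> 'k::field) set \<Rightarrow> (('x \<Rightarrow> 'k) \<Rightarrow> ('x \<Rightarrow> 'k) \<Rightarrow> ('x \<Rightarrow> 'k)) \<Rightarrow> ('x \<Rightarrow> 'k)
     \<Rightarrow> (('x \<Rightarrow> 'k) \<Rightarrow> ('x \<times> 'x \<Rightarrow> 'k)) \<Rightarrow> (('x \<Rightarrow> 'k) \<Rightarrow> 'k) \<Rightarrow> bool" where
  "bialgebra A m u \<Delta> \<epsilon> \<longleftrightarrow>
     unital_algebra A m u \<and> coalgebra A \<Delta> \<epsilon> \<and>
     (\<forall>f\<in>A. \<forall>g\<in>A. \<Delta> (m f g) = tensor_mult A m (\<Delta> f) (\<Delta> g)) \<and> \<Delta> u = u \<otimes>\<^sub>f u \<and>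
     (\<forall>f\<in>A. \<forall>g\<in>A. \<epsilon> (m f g) = \<epsilon> f * \<epsilon> g) \<and> \<epsilon> u = 1"

definition antipode ::
  "('x \<Rightarrow> 'k::field) set \<Rightarrow> (('x \<Rightarrow> 'k) \<Rightarrow> ('x \<Rightarrow> 'k) \<Rightarrow> ('x \<Rightarrow> 'k)) \<Rightarrow> ('x \<Rightarrow> 'k)
     \<Rightarrow> (('x \<Rightarrow> 'k) \<Rightarrow> ('x \<times> 'x \<Rightarrow> 'k)) \<Rightarrow> (('x \<Rightarrow> 'k) \<Rightarrow> 'k) \<Rightarrow> (('x \<Rightarrow> 'k) \<Rightarrow> ('x \<Rightarrow> 'k)) \<Rightarrow> bool" where
  "antipode A m u \<Delta> \<epsilon> S \<longleftrightarrow>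
     linear_on A fscale S \<and> (\<forall>f\<in>A. S f \<in> A) \<and>
     (\<forall>f\<in>A. tensor_lift A A m (tensor_map A A S id (\<Delta> f)) = fscale (\<epsilon> f) u) \<and>
     (\<forall>f\<in>A. tensor_lift A A m (tensor_map A A id S (\<Delta> f)) = fscale (\<epsilon> f) u)"

definition hopf_algebra ::
  "('x \<Rightarrow> 'k::field) set \<Rightarrow> (('x \<Rightarrow> 'k) \<Rightarrow> ('x \<Rightarrow> 'k) \<Rightarrow> ('x \<Rightarrow> 'k)) \<Rightarrow> ('x \<Rightarrow> 'k)
     \<Rightarrow> (('x \<Rightarrow> 'k) \<Rightarrow> ('x \<times> 'x \<Rightarrow> 'k)) \<Rightarrow> (('x \<Rightarrow> 'k) \<Rightarrow> 'k) \<Rightarrow> bool" where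
  "hopf_algebra A m u \<Delta> \<epsilon> \<longleftrightarrow>
     bialgebra A m u \<Delta> \<epsilon> \<and> (\<exists>S. antipode A m u \<Delta> \<epsilon> S)"


section \<open>Combinatorial presheaves\<close>

text \<open>
  The category of finite sets with injections is represented by its equivalent full subcategory
  of finite sets of natural numbers, which contains every \<open>[n] = {1..n}\<close>. An injection
  from \<open>I\<close> to \<open>J\<close> is a function on \<open>nat\<close> of which only the values on \<open>I\<close> matter, and
  \<open>act h I J f\<close> is the map \<open>h[f]\<close> from \<open>h[J]\<close> to \<open>h[I]\<close>. The sets \<open>obj h I\<close> need not be
  disjoint for different \<open>I\<close>, so the underlying set of an object is always passed explicitly.
\<close>

record 'a presheaf =
  obj :: "nat set \<Rightarrow> 'a set"
  act :: "nat set \<Rightarrow> nat set \<Rightarrow> (nat \<Rightarrow> nat) \<Rightarrow> 'a \<Rightarrow> 'a"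

definition injection :: "nat set \<Rightarrow> nat set \<Rightarrow> (nat \<Rightarrow> nat) \<Rightarrow> bool" where
  "injection I J f \<longleftrightarrow> finite I \<and> finite J \<and> f ` I \<subseteq> J \<and> inj_on f I"

locale combinatorial_presheaf =
  fixes h :: "('a, 'b) presheaf_scheme"
  assumes finite_obj: "finite I \<Longrightarrow> finite (obj h I)"
    and act_closed: "\<lbrakk>injection I J f; a \<in> obj h J\<rbrakk> \<Longrightarrow> act h I J f a \<in> obj h I"
    and act_cong: "\<lbrakk>injection I J f; \<And>i. i \<in> I \<Longrightarrow> f i = g i; a \<in> obj h J\<rbrakk>
          \<Longrightarrow> act h I J f a = act h I J g a"
    and act_id: "\<lbrakk>finite I; a \<in> obj h I\<rbrakk> \<Longrightarrow> act h I I id a = a"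
    and act_comp: "\<lbrakk>injection I J f; injection J K g; a \<in> obj h K\<rbrakk>
          \<Longrightarrow> act h I K (g \<circ> f) a = act h I J f (act h J K g a)"

text \<open>\<open>restr h I J a\<close> is the restriction of \<open>a \<in> h[I]\<close> to \<open>J \<subseteq> I\<close>.\<close>

definition restr :: "('a, 'b) presheaf_scheme \<Rightarrow> nat set \<Rightarrow> nat set \<Rightarrow> 'a \<Rightarrow> 'a" where
  "restr h I J a = act h J I id a"

definition iso :: "('a, 'b) presheaf_scheme \<Rightarrow> nat set \<Rightarrow> 'a \<Rightarrow> nat set \<Rightarrow> 'a \<Rightarrow> bool" where
  "iso h I a J b \<longleftrightarrow> (\<exists>f. bij_betw f I J \<and> act h I J f b = a)"

definition iso_rel :: "('a, 'b) presheaf_scheme \<Rightarrow> nat \<Rightarrow> 'a rel" where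
  "iso_rel h n =
     {(a, b). a \<in> obj h {1..n} \<and> b \<in> obj h {1..n} \<and> iso h {1..n} a {1..n} b}"

type_synonym 'a iso_class = "nat \<times> 'a set"

definition iso_classes :: "('a, 'b) presheaf_scheme \<Rightarrow> 'a iso_class set" where
  "iso_classes h = (SIGMA n:UNIV. obj h {1..n} // iso_rel h n)"

definition class_of :: "('a, 'b) presheaf_scheme \<Rightarrow> nat \<Rightarrow> 'a \<Rightarrow> 'a iso_class" where
  "class_of h n a = (n, iso_rel h n `` {a})"

definition rep :: "'a iso_class \<Rightarrow> 'a" where
  "rep A = (SOME a. a \<in> snd A)"

definition occurrences ::
  "('a, 'b) presheaf_scheme \<Rightarrow> nat set \<Rightarrow> 'a \<Rightarrow> nat set \<Rightarrow> 'a \<Rightarrow> nat" where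
  "occurrences h I a J b = card {J'. J' \<subseteq> J \<and> iso h J' (restr h J J' b) I a}"

text \<open>Functions on \<open>iso_classes h\<close> are identified with functions vanishing elsewhere.\<close>

definition pattern_fun :: "('a, 'b) presheaf_scheme \<Rightarrow> 'a iso_class \<Rightarrow> 'a iso_class \<Rightarrow> rat" where
  "pattern_fun h A = (\<lambda>B. if B \<in> iso_classes h
     then of_nat (occurrences h {1..fst A} (rep A) {1..fst B} (rep B)) else 0)"

definition pattern_algebra :: "('a, 'b) presheaf_scheme \<Rightarrow> ('a iso_class \<Rightarrow> rat) set" where
  "pattern_algebra h = fun_space.span (pattern_fun h ` iso_classes h)"

definition pattern_one :: "('a, 'b) presheaf_scheme \<Rightarrow> 'a iso_class \<Rightarrow> rat" where
  "pattern_one h = indicator (iso_classes h)"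


section \<open>Associative presheaves\<close>

record 'a assoc_presheaf = "'a presheaf" +
  star :: "nat set \<Rightarrow> nat set \<Rightarrow> 'a \<Rightarrow> 'a \<Rightarrow> 'a"
  unit_obj :: 'a

locale associative_presheaf = combinatorial_presheaf h
  for h :: "('a, 'b) assoc_presheaf_scheme" +
  assumes star_closed: "\<lbrakk>finite I; finite J; I \<inter> J = {}; a \<in> obj h I; b \<in> obj h J\<rbrakk>
          \<Longrightarrow> star h I J a b \<in> obj h (I \<union> J)"
    and star_natural: "\<lbrakk>finite I; finite J; I \<inter> J = {}; finite I'; finite J'; I' \<inter> J' = {};
            bij_betw f I' I; bij_betw g J' J; a \<in> obj h I; b \<in> obj h J\<rbrakk>
          \<Longrightarrow> act h (I' \<union> J') (I \<union> J) (\<lambda>i. if i \<in> I' then f i else g i) (star h I J a b)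
            = star h I' J' (act h I' I f a) (act h J' J g b)"
    and star_restr: "\<lbrakk>finite I; finite J; I \<inter> J = {}; A \<subseteq> I; B \<subseteq> J; a \<in> obj h I; b \<in> obj h J\<rbrakk>
          \<Longrightarrow> restr h (I \<union> J) (A \<union> B) (star h I J a b) = star h A B (restr h I A a) (restr h J B b)"
    and star_assoc: "\<lbrakk>finite I; finite J; finite K; I \<inter> J = {}; I \<inter> K = {}; J \<inter> K = {};
            a \<in> obj h I; b \<in> obj h J; c \<in> obj h K\<rbrakk>
          \<Longrightarrow> star h (I \<union> J) K (star h I J a b) c = star h I (J \<union> K) a (star h J K b c)"
    and unit_closed: "unit_obj h \<in> obj h {}"
    and star_unit_right: "\<lbrakk>finite I; a \<in> obj h I\<rbrakk> \<Longrightarrow> star h I {} a (unit_obj h) = a"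
    and star_unit_left: "\<lbrakk>finite I; a \<in> obj h I\<rbrakk> \<Longrightarrow> star h {} I (unit_obj h) a = a"

text \<open>The representative of the second factor is relabelled to \<open>{n\<^sub>1 + 1..n\<^sub>1 + n\<^sub>2}\<close>; since
  \<open>act\<close> is contravariant this uses the order preserving bijection onto \<open>{1..n\<^sub>2}\<close>.\<close>

definition class_prod ::
  "('a, 'b) assoc_presheaf_scheme \<Rightarrow> 'a iso_class \<Rightarrow> 'a iso_class \<Rightarrow> 'a iso_class" where
  "class_prod h A B =
     (let n\<^sub>1 = fst A; n\<^sub>2 = fst B; J = {n\<^sub>1 + 1..n\<^sub>1 + n\<^sub>2}
      in class_of h (n\<^sub>1 + n\<^sub>2)
           (star h {1..n\<^sub>1} J (rep A) (act h J {1..n\<^sub>2} (\<lambda>i. i - n\<^sub>1) (rep B))))"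

definition is_coproduct ::
  "('a, 'b) assoc_presheaf_scheme
     \<Rightarrow> (('a iso_class \<Rightarrow> rat) \<Rightarrow> ('a iso_class \<times> 'a iso_class \<Rightarrow> rat)) \<Rightarrow> bool" where
  "is_coproduct h \<Delta> \<longleftrightarrow>
     linear_on (pattern_algebra h) fscale \<Delta> \<and>
     (\<forall>a \<in> iso_classes h. \<Delta> (pattern_fun h a) =
        (\<Sum>(b, c) | b \<in> iso_classes h \<and> c \<in> iso_classes h \<and> class_prod h b c = a.
           pattern_fun h b \<otimes>\<^sub>f pattern_fun h c))"

definition is_counit ::
  "('a, 'b) assoc_presheaf_scheme \<Rightarrow> (('a iso_class \<Rightarrow> rat) \<Rightarrow> rat) \<Rightarrow> bool" where
  "is_counit h \<epsilon> \<longleftrightarrow>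
     linear_on (pattern_algebra h) (*) \<epsilon> \<and>
     (\<forall>a \<in> iso_classes h. \<epsilon> (pattern_fun h a) = (if a = class_of h 0 (unit_obj h) then 1 else 0))"

end

theory Submission
  imports Defs
begin

text \<open>
  View the elements of the pattern algebra as functions on the monoid of isomorphism classes. A
  subset of \<open>I \<union> J\<close> splits into its traces on \<open>I\<close> and \<open>J\<close>, so \<open>\<Delta>\<close> is dual to the product of this
  monoid, \<open>\<Delta> f (x, y) = f (x \<cdot> y)\<close>, and \<open>\<epsilon>\<close> is evaluation at its unit. The coalgebra and bialgebra
  axioms are then pointwise consequences of the monoid axioms, with no need for the linear
  independence of the pattern functions. In the connected case the right translations
  \<open>R\<^sub>x f = f (\<cdot> x)\<close> are unipotent on the pattern algebra, and the antipode is
  \<open>S f x = (R\<^sub>x\<^sup>-\<^sup>1 f) 1\<close>.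
\<close>

section \<open>Linear maps on spans and tensor products\<close>

text \<open>Linear extension from the generators \<open>pattern_fun h a\<close> requires the
  prescribed values to respect every linear relation among them. Taking the coproduct as a formula
  on arbitrary functions settles this: linearity is visible, and the prescribed values become a
  counting identity. The conditions \<open>is_coproduct\<close> and \<open>is_counit\<close> fix
  values on \<open>pattern_algebra h\<close> only, and \<open>tensor_lift\<close> comes from a
  choice, so each of these maps is replaced by a formula on the subspace where it is determined
  before anything is evaluated. The antipode formula imitates a group, where S f x would be f at the
  inverse of x, that is, the translate of f by this inverse, evaluated at 1. Elements of the monoid
  need not have inverses, but right translation by x can still be inverted on functions: when p_a (y
  x) is expanded over the factorizations a = b c, the term with c = 1 is p_a (y) times p_1 (x),
  connectedness gives p_1 = 1, and in all other terms b is smaller than a.\<close>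

lemma linear_on_zero:
  assumes "fun_space.subspace V" "linear_on V s L"
  shows "L 0 = 0"
proof -
  have "0 \<in> V" using assms(1) by (simp add: fun_space.subspace_0)
  \<comment> \<open>\<open>s\<close> is an arbitrary function here, so nothing is known about
    \<open>s 0\<close>; additivity gives the value at 0.\<close>
  then have "L (0 + 0) = L 0 + L 0" using assms(2) unfolding linear_on_def by blast
  then show ?thesis by simp
qed

lemma linear_on_span_eq:
  assumes L: "linear_on (fun_space.span B) s L" and L': "linear_on (fun_space.span B) s L'"
    and eq: "\<And>b. b \<in> B \<Longrightarrow> L b = L' b" and "f \<in> fun_space.span B"
  shows "L f = L' f"
proof -
  let ?U = "{f \<in> fun_space.span B. L f = L' f}"
  have "fun_space.subspace ?U"
    using L L' linear_on_zero[OF fun_space.subspace_span L] linear_on_zero[OF fun_space.subspace_span L']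
    by (auto simp: fun_space.subspace_def linear_on_def fun_space.span_zero fun_space.span_add
        fun_space.span_scale)
  then have "fun_space.span B \<subseteq> ?U"
    using eq by (intro fun_space.span_minimal) (auto intro: fun_space.span_base)
  then show ?thesis using assms(4) by auto
qed

lemma linear_on_span_mem:
  assumes L: "linear_on (fun_space.span B) fscale L" and U: "fun_space.subspace U"
    and mem: "\<And>b. b \<in> B \<Longrightarrow> L b \<in> U" and "f \<in> fun_space.span B"
  shows "L f \<in> U"
proof -
  let ?U = "{f \<in> fun_space.span B. L f \<in> U}"
  have "fun_space.subspace ?U"
    using L U linear_on_zero[OF fun_space.subspace_span L]
    by (auto simp: fun_space.subspace_def linear_on_def fun_space.span_zero fun_space.span_add
        fun_space.span_scale)
  then have "fun_space.span B \<subseteq> ?U"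
    using mem by (intro fun_space.span_minimal) (auto intro: fun_space.span_base)
  then show ?thesis using assms(4) by auto
qed

lemma subspace_tensor: "fun_space.subspace (tensor V W)"
  by (simp add: tensor_def)

lemma tens_mem: "\<lbrakk>f \<in> V; g \<in> W\<rbrakk> \<Longrightarrow> f \<otimes>\<^sub>f g \<in> tensor V W"
  by (auto simp: tensor_def intro: fun_space.span_base)

lemma linear_on_tensor_mem:
  assumes "linear_on (tensor V W) fscale L" "fun_space.subspace U"
    and "\<And>f g. \<lbrakk>f \<in> V; g \<in> W\<rbrakk> \<Longrightarrow> L (f \<otimes>\<^sub>f g) \<in> U" and "t \<in> tensor V W"
  shows "L t \<in> U"
  by (rule linear_on_span_mem[OF assms(1)[unfolded tensor_def] assms(2) _ assms(4)[unfolded tensor_def]])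
    (use assms(3) in auto)

text \<open>Turns the chosen map \<open>tensor_lift\<close> into a formula: it suffices to guess a
  linear \<open>L\<close> with the right values on pure tensors. Bilinearity of
  \<open>\<beta>\<close> is inherited from \<open>L\<close>, and agreement follows because pure
  tensors span.\<close>

lemma tensor_lift_eq:
  fixes V :: "('x \<Rightarrow> 'k::field) set" and W :: "('y \<Rightarrow> 'k) set"
  assumes V: "fun_space.subspace V" and W: "fun_space.subspace W"
    and L: "linear_on (tensor V W) fscale L"
    and \<beta>: "\<And>f g. \<lbrakk>f \<in> V; g \<in> W\<rbrakk> \<Longrightarrow> L (f \<otimes>\<^sub>f g) = \<beta> f g" and t: "t \<in> tensor V W"
  shows "tensor_lift V W \<beta> t = L t"
proof -
  have ta: "(f + f') \<otimes>\<^sub>f g = f \<otimes>\<^sub>f g + f' \<otimes>\<^sub>f g" "fscale c f \<otimes>\<^sub>f g = fscale c (f \<otimes>\<^sub>f g)"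
    "f \<otimes>\<^sub>f (g + g') = f \<otimes>\<^sub>f g + f \<otimes>\<^sub>f g'" "f \<otimes>\<^sub>f fscale c g = fscale c (f \<otimes>\<^sub>f g)"
    for f f' :: "'x \<Rightarrow> 'k" and g g' :: "'y \<Rightarrow> 'k" and c
    by (auto simp: tens_def fscale_def fun_eq_iff algebra_simps)
  have "bilinear_on V W fscale \<beta>"
    using L V W tens_mem[of _ V _ W]
    by (auto simp: bilinear_on_def linear_on_def ta fun_space.subspace_add fun_space.subspace_scale
        simp flip: \<beta>)
  note lift = tensor_lift[OF V W this]
  show ?thesis
    using lift(1) L unfolding tensor_def
    by (rule linear_on_span_eq) (use t lift(2) \<beta> in \<open>auto simp: tensor_def\<close>)
qed

text \<open>A section of \<open>f \<otimes>\<^sub>f g\<close> is a multiple of \<open>f\<close>.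
  Hence a map controlled only on \<open>V\<close> may be applied in the first variable of any
  element of \<open>tensor V W\<close>.\<close>

lemma tensor_section_left:
  assumes "fun_space.subspace V" "t \<in> tensor V W"
  shows "(\<lambda>x. t (x, y)) \<in> V"
proof (rule linear_on_tensor_mem[OF _ assms(1) _ assms(2)])
  show "(\<lambda>x. (f \<otimes>\<^sub>f g) (x, y)) \<in> V" if "f \<in> V" for f g
    using fun_space.subspace_scale[OF assms(1) that, of "g y"]
    by (simp add: tens_def fscale_def mult.commute)
qed (auto simp: linear_on_def fscale_def)

lemma tensor_section_right:
  assumes "fun_space.subspace W" "t \<in> tensor V W"
  shows "(\<lambda>y. t (x, y)) \<in> W"
proof (rule linear_on_tensor_mem[OF _ assms(1) _ assms(2)])
  show "(\<lambda>y. (f \<otimes>\<^sub>f g) (x, y)) \<in> W" if "g \<in> W" for f g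
    using fun_space.subspace_scale[OF assms(1) that, of "f x"]
    by (simp add: tens_def fscale_def)
qed (auto simp: linear_on_def fscale_def)

lemma tensor_lift_times:
  fixes V :: "('x \<Rightarrow> 'k::field) set"
  assumes "fun_space.subspace V" "t \<in> tensor V V"
  shows "tensor_lift V V (*) t = (\<lambda>x. t (x, x))"
  by (rule tensor_lift_eq[OF assms(1) assms(1) _ _ assms(2)])
    (auto simp: linear_on_def fscale_def tens_def fun_eq_iff)

lemma tensor_mult_times:
  fixes V :: "('x \<Rightarrow> 'k::field) set"
  assumes V: "fun_space.subspace V" and t: "t \<in> tensor V V" and t': "t' \<in> tensor V V"
  shows "tensor_mult V (*) t t' = t * t'"
  unfolding tensor_mult_def
proof (rule tensor_lift_eq[OF V V _ _ t])
  \<comment> \<open>For fixed \<open>f\<close> and \<open>g\<close> the inner lift is multiplication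
    by \<open>f \<otimes>\<^sub>f g\<close>, which is linear in that pure tensor, as the outer lift
    requires.\<close>
  show "(f \<otimes>\<^sub>f g) * t' = tensor_lift V V (\<lambda>f' g'. (f * f') \<otimes>\<^sub>f (g * g')) t'" for f g :: "'x \<Rightarrow> 'k"
    by (rule tensor_lift_eq[OF V V _ _ t', symmetric])
      (auto simp: linear_on_def fscale_def tens_def fun_eq_iff algebra_simps)
qed (auto simp: linear_on_def fscale_def fun_eq_iff algebra_simps)

lemma tensor_map_id_right:
  assumes V: "fun_space.subspace V" and W: "fun_space.subspace W" and F: "linear_on V fscale F"
    and t: "t \<in> tensor V W"
  shows "tensor_map V W F id t = (\<lambda>(u, y). F (\<lambda>x. t (x, y)) u)"
  unfolding tensor_map_def
proof (rule tensor_lift_eq[OF V W _ _ t])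
  show "linear_on (tensor V W) fscale (\<lambda>t (u, y). F (\<lambda>x. t (x, y)) u)"
    using F tensor_section_left[OF V, of _ W]
    by (auto simp: linear_on_def fun_eq_iff fscale_def plus_fun_def)
  show "(\<lambda>(u, y). F (\<lambda>x. (f \<otimes>\<^sub>f g) (x, y)) u) = F f \<otimes>\<^sub>f id g" if "f \<in> V" for f g
  proof -
    have "F (\<lambda>x. f x * c) = (\<lambda>u. F f u * c)" for c
    proof -
      have "(\<lambda>x. f x * c) = fscale c f" by (simp add: fscale_def mult.commute)
      then show ?thesis using F that by (simp add: linear_on_def fscale_def mult.commute)
    qed
    then show ?thesis by (simp add: tens_def)
  qed
qed

lemma tensor_map_id_left:
  assumes V: "fun_space.subspace V" and W: "fun_space.subspace W" and F: "linear_on W fscale F"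
    and t: "t \<in> tensor V W"
  shows "tensor_map V W id F t = (\<lambda>(x, u). F (\<lambda>y. t (x, y)) u)"
  unfolding tensor_map_def
proof (rule tensor_lift_eq[OF V W _ _ t])
  show "linear_on (tensor V W) fscale (\<lambda>t (x, u). F (\<lambda>y. t (x, y)) u)"
    using F tensor_section_right[OF W, of _ V]
    by (auto simp: linear_on_def fun_eq_iff fscale_def plus_fun_def)
  show "(\<lambda>(x, u). F (\<lambda>y. (f \<otimes>\<^sub>f g) (x, y)) u) = id f \<otimes>\<^sub>f F g" if "g \<in> W" for f g
  proof -
    have "F (fscale c g) = fscale c (F g)" for c using F that by (simp add: linear_on_def)
    then show ?thesis by (simp add: tens_def fscale_def)
  qed
qed

lemma tensor_map_mem:
  assumes V: "fun_space.subspace V" and W: "fun_space.subspace W"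
    and F: "linear_on V fscale F" "F ` V \<subseteq> V'" and G: "linear_on W fscale G" "G ` W \<subseteq> W'"
    and t: "t \<in> tensor V W"
  shows "tensor_map V W F G t \<in> tensor V' W'"
proof -
  have "bilinear_on V W fscale (\<lambda>f g. F f \<otimes>\<^sub>f G g)"
    using F(1) G(1) by (auto simp: bilinear_on_def linear_on_def tens_def fscale_def fun_eq_iff algebra_simps)
  note lift = tensor_lift[OF V W this]
  show ?thesis
    unfolding tensor_map_def
    by (rule linear_on_tensor_mem[OF lift(1) subspace_tensor _ t])
      (use F(2) G(2) in \<open>auto simp: lift(2) intro: tens_mem\<close>)
qed

section \<open>Isomorphism classes\<close>

lemma injection_subset: "\<lbrakk>finite J; I \<subseteq> J\<rbrakk> \<Longrightarrow> injection I J id"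
  by (auto simp: injection_def finite_subset)

lemma injection_bij: "\<lbrakk>finite I; bij_betw f I J\<rbrakk> \<Longrightarrow> injection I J f"
  by (auto simp: injection_def bij_betw_def)

context combinatorial_presheaf
begin

lemma restr_closed: "\<lbrakk>finite I; J \<subseteq> I; a \<in> obj h I\<rbrakk> \<Longrightarrow> restr h I J a \<in> obj h J"
  unfolding restr_def by (intro act_closed injection_subset)

lemma restr_restr:
  assumes "finite I" "J \<subseteq> I" "K \<subseteq> J" "a \<in> obj h I"
  shows "restr h J K (restr h I J a) = restr h I K a"
  using act_comp[OF injection_subset injection_subset, of J K I a] assms finite_subset[of J I]
  by (simp add: restr_def)

text \<open>Both sides are the action of one injection of \<open>S\<close> into \<open>J\<close>,
  factored as an inclusion followed by \<open>f\<close>, or as \<open>f\<close> onto the image of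
  \<open>S\<close> followed by an inclusion.\<close>

lemma restr_act:
  assumes "finite I" "bij_betw f I J" "S \<subseteq> I" "a \<in> obj h J"
  shows "restr h I S (act h I J f a) = act h S (f ` S) f (restr h J (f ` S) a)"
proof -
  have fin: "finite J" "f ` S \<subseteq> J" "finite S"
    using assms bij_betw_finite finite_subset by (auto simp: bij_betw_def)
  have "act h S I id (act h I J f a) = act h S J (f \<circ> id) a"
    using act_comp[OF injection_subset injection_bij] assms by metis
  moreover have "bij_betw f S (f ` S)"
    using assms by (auto simp: bij_betw_def inj_on_subset)
  then have "act h S J (id \<circ> f) a = act h S (f ` S) f (act h (f ` S) J id a)"
    using fin assms by (intro act_comp injection_bij injection_subset) auto
  ultimately show ?thesis by (simp add: restr_def)
qed

lemma iso_refl: "\<lbrakk>finite I; a \<in> obj h I\<rbrakk> \<Longrightarrow> iso h I a I a"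
  unfolding iso_def using act_id by (intro exI[of _ id]) auto

lemma iso_sym:
  assumes "finite I" "b \<in> obj h J" "iso h I a J b"
  shows "iso h J b I a"
proof -
  obtain f where f: "bij_betw f I J" "act h I J f b = a"
    using assms by (auto simp: iso_def)
  let ?g = "inv_into I f"
  have g: "bij_betw ?g J I" using f by (simp add: bij_betw_inv_into)
  have J: "finite J" using f assms bij_betw_finite by auto
  have "act h J I ?g a = act h J J (f \<circ> ?g) b"
    using act_comp[OF injection_bij[OF J g] injection_bij[OF assms(1) f(1)] assms(2)] f by simp
  \<comment> \<open>\<open>f \<circ> ?g\<close> agrees with \<open>id\<close> on \<open>J\<close>
    only; \<open>act_cong\<close> discards the other values.\<close>
  also have "\<dots> = act h J J id b"
    using f g J assms by (intro act_cong injection_bij)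
      (auto simp: bij_betw_inv_into_right intro: bij_betw_trans)
  finally show ?thesis using act_id g J assms by (auto simp: iso_def)
qed

lemma iso_trans:
  assumes "finite I" "c \<in> obj h K" "iso h I a J b" "iso h J b K c"
  shows "iso h I a K c"
proof -
  obtain f g where f: "bij_betw f I J" "act h I J f b = a" and g: "bij_betw g J K" "act h J K g c = b"
    using assms by (auto simp: iso_def)
  have "finite J" using f assms bij_betw_finite by auto
  then have "act h I K (g \<circ> f) c = a"
    using act_comp[OF injection_bij injection_bij, of I f J g K c] f g assms by simp
  then show ?thesis using bij_betw_trans[OF f(1) g(1)] by (auto simp: iso_def)
qed

text \<open>Extends \<open>class_of\<close> to objects on arbitrary finite sets, see \<open>class_of_eq_cls\<close>.\<close>

definition cls :: "nat set \<Rightarrow> 'a \<Rightarrow> 'a iso_class" where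
  "cls I a = (card I, {b \<in> obj h {1..card I}. iso h {1..card I} b I a})"

lemma fst_cls [simp]: "fst (cls I a) = card I"
  by (simp add: cls_def)

lemma act_iso: "bij_betw f I J \<Longrightarrow> iso h I (act h I J f b) J b"
  by (auto simp: iso_def)

lemma standard_copy:
  assumes "finite I" "a \<in> obj h I"
  obtains b where "b \<in> obj h {1..card I}" "iso h {1..card I} b I a"
proof -
  obtain f where "bij_betw f {1..card I} I"
    using ex_bij_betw_nat_finite_1[OF assms(1)] by auto
  then show ?thesis using assms by (intro that[of "act h {1..card I} I f a"])
      (auto intro: act_iso act_closed injection_bij)
qed

text \<open>\<open>standard_copy\<close> makes the second components non-empty, so equal classes
  share a member on \<open>{1..card I}\<close>, and the isomorphism passes through it.\<close>

lemma cls_eq_iff: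
  assumes "finite I" "a \<in> obj h I" "finite J" "b \<in> obj h J"
  shows "cls I a = cls J b \<longleftrightarrow> iso h I a J b"
proof
  assume eq: "cls I a = cls J b"
  obtain c where c: "c \<in> obj h {1..card I}" "iso h {1..card I} c I a"
    using standard_copy assms by metis
  then have "c \<in> snd (cls J b)" unfolding eq[symmetric] by (simp add: cls_def)
  moreover have "card I = card J" using arg_cong[OF eq, of fst] by simp
  ultimately have "iso h {1..card I} c J b" by (simp add: cls_def)
  then show "iso h I a J b"
    using iso_trans[OF assms(1,4) iso_sym[OF _ assms(2) c(2)]] by simp
next
  assume i: "iso h I a J b"
  then have "card I = card J" by (auto simp: iso_def bij_betw_same_card)
  moreover have "iso h {1..card I} c I a \<longleftrightarrow> iso h {1..card I} c J b" for c
    using iso_trans[OF _ assms(4) _ i] iso_trans[OF _ assms(2) _ iso_sym[OF assms(1,4) i]] by blast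
  ultimately show "cls I a = cls J b" by (auto simp: cls_def)
qed

lemma cls_act:
  assumes "finite I" "bij_betw f I J" "a \<in> obj h J"
  shows "cls I (act h I J f a) = cls J a"
  using assms bij_betw_finite[OF assms(2)] act_closed injection_bij
  by (subst cls_eq_iff) (auto intro: act_iso)

lemma class_of_eq_cls: "a \<in> obj h {1..n} \<Longrightarrow> class_of h n a = cls {1..n} a"
  by (auto simp: class_of_def cls_def iso_rel_def intro: iso_sym)

lemma cls_in_iso_classes:
  assumes "finite I" "a \<in> obj h I"
  shows "cls I a \<in> iso_classes h"
proof -
  obtain b where b: "b \<in> obj h {1..card I}" "iso h {1..card I} b I a"
    using standard_copy assms by metis
  then have "cls I a = class_of h (card I) b"
    using assms by (subst class_of_eq_cls) (auto simp: cls_eq_iff intro: iso_sym)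
  then show ?thesis using b by (auto simp: iso_classes_def class_of_def quotient_def)
qed

lemma iso_class_rep:
  assumes "A \<in> iso_classes h"
  shows "rep A \<in> obj h {1..fst A}" "cls {1..fst A} (rep A) = A"
proof -
  obtain a where a: "a \<in> obj h {1..fst A}" "A = class_of h (fst A) a"
    using assms by (auto simp: iso_classes_def class_of_def quotient_def)
  then have A: "A = cls {1..fst A} a" by (simp add: class_of_eq_cls)
  moreover have "a \<in> snd (cls {1..fst A} a)"
    using a by (auto simp: cls_def iso_refl)
  ultimately have "rep A \<in> snd (cls {1..fst A} a)"
    by (metis rep_def someI)
  then have r: "rep A \<in> obj h {1..fst A}" "iso h {1..fst A} (rep A) {1..fst A} a"
    by (auto simp: cls_def)
  then show "rep A \<in> obj h {1..fst A}" by simp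
  show "cls {1..fst A} (rep A) = A" using A r a cls_eq_iff by (metis finite_atLeastAtMost)
qed

lemma iso_class_on:
  assumes "A \<in> iso_classes h" "finite I" "card I = fst A"
  obtains a where "a \<in> obj h I" "cls I a = A"
proof -
  obtain f where f: "bij_betw f I {1..fst A}"
    using assms finite_same_card_bij[of I "{1..fst A}"] by auto
  show ?thesis
    using f assms iso_class_rep[OF assms(1)]
    by (intro that[of "act h I {1..fst A} f (rep A)"]) (auto simp: cls_act intro: act_closed injection_bij)
qed

lemma finite_iso_classes_bounded: "finite {A \<in> iso_classes h. fst A \<le> n}"
proof -
  have "{A \<in> iso_classes h. fst A \<le> n} \<subseteq> (\<lambda>(m, a). cls {1..m} a) ` (SIGMA m:{..n}. obj h {1..m})"
  proof
    fix A assume "A \<in> {A \<in> iso_classes h. fst A \<le> n}"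
    then show "A \<in> (\<lambda>(m, a). cls {1..m} a) ` (SIGMA m:{..n}. obj h {1..m})"
      using iso_class_rep[of A] by (intro image_eqI[of _ _ "(fst A, rep A)"]) auto
  qed
  then show ?thesis by (rule finite_subset) (auto intro: finite_obj)
qed

lemma cls_restr_act:
  assumes "finite I" "bij_betw f I J" "S \<subseteq> I" "a \<in> obj h J"
  shows "cls S (restr h I S (act h I J f a)) = cls (f ` S) (restr h J (f ` S) a)"
proof -
  have "finite J" "f ` S \<subseteq> J" "finite S" "bij_betw f S (f ` S)"
    using assms bij_betw_finite finite_subset by (auto simp: bij_betw_def inj_on_subset)
  then show ?thesis using assms by (simp add: restr_act cls_act restr_closed)
qed

section \<open>Pattern functions\<close>

text \<open>An isomorphism from \<open>rep (cls J b)\<close> to \<open>b\<close> carries subsets to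
  subsets and matches restrictions up to isomorphism. Occurrences can thus be counted in any
  representative on any finite set.\<close>

lemma pattern_fun_cls:
  assumes A: "A \<in> iso_classes h" and J: "finite J" "b \<in> obj h J"
  shows "pattern_fun h A (cls J b) = of_nat (card {S. S \<subseteq> J \<and> cls S (restr h J S b) = A})"
proof -
  let ?n = "card J" and ?B = "cls J b"
  have B: "?B \<in> iso_classes h" using J by (rule cls_in_iso_classes)
  note r = iso_class_rep[OF B, unfolded fst_cls] and ra = iso_class_rep[OF A]
  have "iso h {1..?n} (rep ?B) J b" using r J cls_eq_iff by (metis finite_atLeastAtMost)
  then obtain f where f: "bij_betw f {1..?n} J" "act h {1..?n} J f b = rep ?B"
    by (auto simp: iso_def)
  have "iso h S (restr h {1..?n} S (rep ?B)) {1..fst A} (rep A) \<longleftrightarrow> cls (f ` S) (restr h J (f ` S) b) = A"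
    if S: "S \<subseteq> {1..?n}" for S
  proof -
    have "iso h S (restr h {1..?n} S (rep ?B)) {1..fst A} (rep A) \<longleftrightarrow>
        cls S (restr h {1..?n} S (rep ?B)) = cls {1..fst A} (rep A)"
      using S r ra finite_subset[OF S] by (subst cls_eq_iff) (auto intro: restr_closed)
    also have "cls S (restr h {1..?n} S (rep ?B)) = cls (f ` S) (restr h J (f ` S) b)"
      using S f J by (simp flip: f(2) add: cls_restr_act)
    finally show ?thesis using ra by simp
  qed
  then have occ: "{S. S \<subseteq> {1..?n} \<and> iso h S (restr h {1..?n} S (rep ?B)) {1..fst A} (rep A)}
      = {S \<in> Pow {1..?n}. cls (f ` S) (restr h J (f ` S) b) = A}" by auto
  have bij: "inj_on ((`) f) (Pow {1..?n})" "(`) f ` Pow {1..?n} = Pow J"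
    using bij_betw_Pow[OF f(1)] by (auto simp: bij_betw_def)
  have "bij_betw ((`) f) {S \<in> Pow {1..?n}. cls (f ` S) (restr h J (f ` S) b) = A}
      {S. S \<subseteq> J \<and> cls S (restr h J S b) = A}"
    unfolding bij_betw_def
  proof
    show "inj_on ((`) f) {S \<in> Pow {1..?n}. cls (f ` S) (restr h J (f ` S) b) = A}"
      by (rule inj_on_subset[OF bij(1)]) auto
    have "(`) f ` {S \<in> Pow {1..?n}. cls (f ` S) (restr h J (f ` S) b) = A}
        = {S \<in> (`) f ` Pow {1..?n}. cls S (restr h J S b) = A}" by blast
    then show "(`) f ` {S \<in> Pow {1..?n}. cls (f ` S) (restr h J (f ` S) b) = A}
        = {S. S \<subseteq> J \<and> cls S (restr h J S b) = A}" by (simp only: bij(2) Pow_iff)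
  qed
  from bij_betw_same_card[OF this] show ?thesis
    using B by (simp add: pattern_fun_def occurrences_def occ del: One_nat_def)
qed

lemma pattern_fun_eq:
  assumes "A \<in> iso_classes h" "B \<in> iso_classes h"
  shows "pattern_fun h A B
    = of_nat (card {S. S \<subseteq> {1..fst B} \<and> cls S (restr h {1..fst B} S (rep B)) = A})"
  using pattern_fun_cls[OF assms(1), of "{1..fst B}" "rep B"] iso_class_rep[OF assms(2)] by simp

lemma pattern_fun_off: "B \<notin> iso_classes h \<Longrightarrow> pattern_fun h A B = 0"
  by (simp add: pattern_fun_def)

lemma subspace_pattern_algebra: "fun_space.subspace (pattern_algebra h)"
  by (simp add: pattern_algebra_def)

lemma pattern_fun_mem: "A \<in> iso_classes h \<Longrightarrow> pattern_fun h A \<in> pattern_algebra h"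
  by (auto simp: pattern_algebra_def intro: fun_space.span_base)

text \<open>The structure constants of the product: pairs of occurrences of \<open>A\<close> and \<open>B\<close> are sorted by
  their union.\<close>

definition overlaps :: "'a iso_class \<Rightarrow> 'a iso_class \<Rightarrow> nat set \<Rightarrow> 'a \<Rightarrow> nat" where
  "overlaps A B I a =
     card {(S, T). S \<union> T = I \<and> cls S (restr h I S a) = A \<and> cls T (restr h I T a) = B}"

lemma overlaps_iso:
  assumes "finite I" "b \<in> obj h J" "iso h I a J b"
  shows "overlaps A B I a = overlaps A B J b"
proof -
  obtain f where f: "bij_betw f I J" "act h I J f b = a"
    using assms by (auto simp: iso_def)
  let ?P = "\<lambda>I a. {(S, T). S \<union> T = I \<and> cls S (restr h I S a) = A \<and> cls T (restr h I T a) = B}"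
  have im: "f ` I = J" and inj: "inj_on f I" using f by (auto simp: bij_betw_def)
  have cr: "cls S (restr h I S a) = cls (f ` S) (restr h J (f ` S) b)" if "S \<subseteq> I" for S
    using cls_restr_act[OF assms(1) f(1) that assms(2)] f(2) by simp
  have "bij_betw (map_prod ((`) f) ((`) f)) (?P I a) (?P J b)"
    unfolding bij_betw_def
  proof
    have "inj_on (map_prod ((`) f) ((`) f)) (Pow I \<times> Pow I)"
      by (intro map_prod_inj_on inj_on_image_Pow inj)
    then show "inj_on (map_prod ((`) f) ((`) f)) (?P I a)"
      by (rule inj_on_subset) auto
    show "map_prod ((`) f) ((`) f) ` ?P I a = ?P J b"
    proof (intro equalityI subsetI)
      fix p assume "p \<in> map_prod ((`) f) ((`) f) ` ?P I a"
      then obtain S T where "p = (f ` S, f ` T)" "S \<union> T = I"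
        "cls S (restr h I S a) = A" "cls T (restr h I T a) = B" by auto
      then show "p \<in> ?P J b" using cr[of S] cr[of T] im by (auto simp flip: image_Un)
    next
      fix p assume "p \<in> ?P J b"
      then obtain S T where p: "p = (S, T)" "S \<union> T = J"
        "cls S (restr h J S b) = A" "cls T (restr h J T b) = B" by auto
      let ?S = "f -` S \<inter> I" and ?T = "f -` T \<inter> I"
      have "f ` (f -` S' \<inter> I) = S'" if "S' \<subseteq> J" for S' using that im by blast
      then have "f ` ?S = S" "f ` ?T = T" "?S \<union> ?T = I" using p(2) im by auto
      then show "p \<in> map_prod ((`) f) ((`) f) ` ?P I a"
        using cr[of ?S] cr[of ?T] p by (intro image_eqI[of _ _ "(?S, ?T)"]) auto
    qed
  qed
  then show ?thesis unfolding overlaps_def by (rule bij_betw_same_card)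
qed

lemma overlaps_rep:
  assumes "finite I" "a \<in> obj h I"
  shows "overlaps A B {1..card I} (rep (cls I a)) = overlaps A B I a"
proof (rule overlaps_iso)
  show "iso h {1..card I} (rep (cls I a)) I a"
    using iso_class_rep[OF cls_in_iso_classes[OF assms]] assms
    by (subst cls_eq_iff[symmetric]) auto
qed (use assms in auto)

text \<open>An occurrence of \<open>A\<close> and one of \<open>B\<close> that cover
  \<open>{1..fst C}\<close> have sizes adding up to at least \<open>fst C\<close>. This makes a
  product of two pattern functions a finite linear combination.\<close>

lemma overlaps_eq_0:
  assumes "overlaps A B {1..fst C} c \<noteq> 0"
  shows "fst C \<le> fst A + fst B"
proof -
  have "{(S, T). S \<union> T = {1..fst C} \<and> cls S (restr h {1..fst C} S c) = A
      \<and> cls T (restr h {1..fst C} T c) = B} \<noteq> {}"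
    using assms unfolding overlaps_def by (metis card.empty)
  then obtain S T where "S \<union> T = {1..fst C}" "cls S (restr h {1..fst C} S c) = A"
    "cls T (restr h {1..fst C} T c) = B"
    by blast
  then have "fst C = card (S \<union> T)" "card S = fst A" "card T = fst B" by auto
  then show ?thesis using card_Un_le[of S T] by simp
qed

text \<open>Double counting of the pairs of an occurrence S of \<open>A\<close> and an occurrence T
  of \<open>B\<close> in \<open>x\<close>. For each U, the number of pairs with union U depends only
  on the class of the restriction to U; collecting the sets U by this class gives the coefficient
  \<open>overlaps\<close> times the number of occurrences of the class.\<close>

lemma pattern_fun_mult:
  assumes A: "A \<in> iso_classes h" and B: "B \<in> iso_classes h"
  shows "pattern_fun h A * pattern_fun h B
    = (\<Sum>C | C \<in> iso_classes h \<and> fst C \<le> fst A + fst B.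
        fscale (of_nat (overlaps A B {1..fst C} (rep C))) (pattern_fun h C))"
proof
  fix x
  let ?q = "\<lambda>C. overlaps A B {1..fst C} (rep C)"
  show "(pattern_fun h A * pattern_fun h B) x
      = (\<Sum>C | C \<in> iso_classes h \<and> fst C \<le> fst A + fst B. fscale (of_nat (?q C)) (pattern_fun h C)) x"
  proof (cases "x \<in> iso_classes h")
    case x: True
    define I where "I = {1..fst x}"
    have I: "finite I" by (simp add: I_def)
    define r where "r = rep x"
    have r: "r \<in> obj h I" using iso_class_rep[OF x] by (simp add: I_def r_def)
    let ?k = "\<lambda>S. cls S (restr h I S r)"
    let ?p = "\<lambda>C. {S. S \<subseteq> I \<and> ?k S = C}"
    have p: "pattern_fun h C x = of_nat (card (?p C))" if "C \<in> iso_classes h" for C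
      using that x by (simp add: pattern_fun_eq I_def r_def)
    let ?X = "?p A \<times> ?p B"
    \<comment> \<open>The extra \<open>fst x\<close> puts the class of every
      \<open>U \<subseteq> I\<close> into \<open>?Y\<close>, as \<open>sum.group\<close> demands;
      \<open>overlaps_eq_0\<close> removes the surplus at the end.\<close>
    let ?Y = "{C \<in> iso_classes h. fst C \<le> fst A + fst B + fst x}"
    have fX: "finite ?X" using I by auto
    have kG: "?k U \<in> iso_classes h" "fst (?k U) \<le> fst x" "finite U" if "U \<subseteq> I" for U
      using that I r card_mono[OF I that] finite_subset[OF that I]
      by (auto intro!: cls_in_iso_classes restr_closed) (simp add: I_def)
    have "(\<lambda>w. fst w \<union> snd w) ` ?X \<subseteq> Pow I" by fastforce
    from sum.group[OF fX _ this, of "\<lambda>_. 1::nat"]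
    have "card ?X = (\<Sum>U\<in>Pow I. card {w \<in> ?X. fst w \<union> snd w = U})"
      using I by (simp only: card_eq_sum finite_Pow_iff)
    also have "\<dots> = (\<Sum>U\<in>Pow I. ?q (?k U))"
    proof (rule sum.cong)
      fix U assume "U \<in> Pow I"
      then have U: "U \<subseteq> I" by simp
      have "{w \<in> ?X. fst w \<union> snd w = U} = {(S, T). S \<union> T = U \<and>
          cls S (restr h U S (restr h I U r)) = A \<and> cls T (restr h U T (restr h I U r)) = B}"
        using restr_restr[OF I U _ r] U by auto
      then have "card {w \<in> ?X. fst w \<union> snd w = U} = overlaps A B U (restr h I U r)"
        by (simp add: overlaps_def)
      then show "card {w \<in> ?X. fst w \<union> snd w = U} = ?q (?k U)"
        using overlaps_rep[OF kG(3)[OF U] restr_closed[OF I U r]] by simp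
    qed simp
    also have "\<dots> = (\<Sum>C\<in>?Y. \<Sum>U\<in>{U \<in> Pow I. ?k U = C}. ?q (?k U))"
      using I kG finite_iso_classes_bounded
      by (intro sum.group[symmetric]) (auto intro: trans_le_add2)
    also have "\<dots> = (\<Sum>C\<in>?Y. ?q C * card (?p C))"
      by (rule sum.cong) auto
    also have "\<dots> = (\<Sum>C | C \<in> iso_classes h \<and> fst C \<le> fst A + fst B. ?q C * card (?p C))"
    proof (intro sum.mono_neutral_right ballI)
      fix C assume "C \<in> ?Y - {C \<in> iso_classes h. fst C \<le> fst A + fst B}"
      then show "?q C * card (?p C) = 0" using overlaps_eq_0[of A B C "rep C"] by force
    qed (use finite_iso_classes_bounded in auto)
    finally have "of_nat (card ?X)
        = (\<Sum>C | C \<in> iso_classes h \<and> fst C \<le> fst A + fst B. of_nat (?q C) * of_nat (card (?p C)) :: rat)"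
      by simp
    then show ?thesis using A B
      by (simp add: p sum_fun_apply fscale_def card_cartesian_product)
  qed (simp add: pattern_fun_off sum_fun_apply fscale_def)
qed

lemma pattern_fun_mult_mem:
  assumes "A \<in> iso_classes h" "B \<in> iso_classes h"
  shows "pattern_fun h A * pattern_fun h B \<in> pattern_algebra h"
  unfolding pattern_fun_mult[OF assms] pattern_algebra_def
  by (intro fun_space.span_sum fun_space.span_scale fun_space.span_base) auto

end

section \<open>The monoid of isomorphism classes of an associative presheaf\<close>

context associative_presheaf
begin

abbreviation one_class :: "'a iso_class" where
  "one_class \<equiv> class_of h 0 (unit_obj h)"

lemma one_class_eq: "one_class = cls {} (unit_obj h)"
  using class_of_eq_cls[of "unit_obj h" 0] unit_closed by simp

lemma one_class_mem: "one_class \<in> iso_classes h"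
  unfolding one_class_eq by (intro cls_in_iso_classes unit_closed) simp

text \<open>Frees the product from the standard positions: by \<open>star_natural\<close>,
  isomorphisms of the two factors onto \<open>a\<close> and \<open>b\<close> glue to an isomorphism
  of the star products.\<close>

lemma class_prod_cls:
  assumes I: "finite I" "a \<in> obj h I" and J: "finite J" "b \<in> obj h J" and "I \<inter> J = {}"
  shows "class_prod h (cls I a) (cls J b) = cls (I \<union> J) (star h I J a b)"
proof -
  define m n K where "m = card I" and "n = card J" and "K = {m + 1..m + n}"
  define s where "s = (\<lambda>i. i - m)"
  have iso_rep: "\<exists>f. bij_betw f {1..card I} I \<and> act h {1..card I} I f a = rep (cls I a)"
    if "finite I" "a \<in> obj h I" for I a
    using iso_class_rep[OF cls_in_iso_classes[OF that]] that
      cls_eq_iff[of "{1..card I}" "rep (cls I a)" I a] by (auto simp: iso_def)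
  obtain f where f: "bij_betw f {1..m} I" "act h {1..m} I f a = rep (cls I a)"
    using iso_rep[OF I] by (auto simp: m_def)
  obtain g where g: "bij_betw g {1..n} J" "act h {1..n} J g b = rep (cls J b)"
    using iso_rep[OF J] by (auto simp: n_def)
  have s: "bij_betw s K {1..n}"
    by (rule bij_betw_byWitness[where f' = "\<lambda>i. i + m"]) (auto simp: s_def K_def)
  have gs: "bij_betw (g \<circ> s) K J" using bij_betw_trans[OF s g(1)] .
  have K: "finite K" "{1..m} \<inter> K = {}" "{1..m} \<union> K = {1..m + n}"
    by (auto simp: K_def)
  have "act h K {1..n} s (rep (cls J b)) = act h K J (g \<circ> s) b"
    using act_comp[OF injection_bij[OF K(1) s] injection_bij[OF _ g(1)]] J g by simp
  then have "class_prod h (cls I a) (cls J b)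
      = class_of h (m + n) (star h {1..m} K (act h {1..m} I f a) (act h K J (g \<circ> s) b))"
    unfolding class_prod_def Let_def f(2) K_def s_def fst_cls m_def[symmetric] n_def[symmetric]
    by simp
  also have "\<dots> = cls ({1..m} \<union> K) (star h {1..m} K (act h {1..m} I f a) (act h K J (g \<circ> s) b))"
    unfolding K(3)
    using I J f(1) gs
    by (intro class_of_eq_cls star_closed[OF finite_atLeastAtMost K(1,2), unfolded K(3)]
        act_closed injection_bij K(1)) auto
  also have "\<dots> = cls ({1..m} \<union> K)
      (act h ({1..m} \<union> K) (I \<union> J) (\<lambda>i. if i \<in> {1..m} then f i else (g \<circ> s) i) (star h I J a b))"
    using assms K f(1) gs by (subst star_natural) auto
  also have "\<dots> = cls (I \<union> J) (star h I J a b)"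
    using assms K f(1) gs by (intro cls_act bij_betw_disjoint_Un star_closed) (auto simp: comp_def)
  finally show ?thesis .
qed

text \<open>Consecutive intervals carry the three classes. On such disjoint supports the monoid laws
  are the presheaf laws for \<open>star\<close>, as equalities of objects.\<close>

lemma disjoint_copies:
  assumes "x \<in> iso_classes h" "y \<in> iso_classes h" "z \<in> iso_classes h"
  obtains I a J b K c where "finite I" "a \<in> obj h I" "x = cls I a" "finite J" "b \<in> obj h J" "y = cls J b"
    "finite K" "c \<in> obj h K" "z = cls K c" "I \<inter> J = {}" "I \<inter> K = {}" "J \<inter> K = {}"
proof -
  let ?I = "{1..fst x}" and ?J = "{fst x + 1..fst x + fst y}"
    and ?K = "{fst x + fst y + 1..fst x + fst y + fst z}"
  obtain a where "a \<in> obj h ?I" "cls ?I a = x" by (rule iso_class_on[OF assms(1), of ?I]) auto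
  moreover obtain b where "b \<in> obj h ?J" "cls ?J b = y" by (rule iso_class_on[OF assms(2), of ?J]) auto
  moreover obtain c where "c \<in> obj h ?K" "cls ?K c = z" by (rule iso_class_on[OF assms(3), of ?K]) auto
  ultimately show ?thesis by (intro that[of ?I a ?J b ?K c]) auto
qed

lemma class_prod_mem:
  assumes "x \<in> iso_classes h" "y \<in> iso_classes h"
  shows "class_prod h x y \<in> iso_classes h"
  by (rule disjoint_copies[OF assms assms(1)]) (simp add: class_prod_cls cls_in_iso_classes star_closed)

lemma fst_class_prod [simp]: "fst (class_prod h x y) = fst x + fst y"
  by (simp add: class_prod_def Let_def class_of_def)

lemma class_prod_assoc:
  assumes "x \<in> iso_classes h" "y \<in> iso_classes h" "z \<in> iso_classes h"
  shows "class_prod h (class_prod h x y) z = class_prod h x (class_prod h y z)"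
  by (rule disjoint_copies[OF assms])
    (simp add: class_prod_cls star_closed star_assoc Un_assoc Int_Un_distrib Int_Un_distrib2)

lemma class_prod_one:
  assumes "x \<in> iso_classes h"
  shows "class_prod h one_class x = x" "class_prod h x one_class = x"
  by (rule disjoint_copies[OF assms assms assms],
      simp add: one_class_eq class_prod_cls unit_closed star_unit_left star_unit_right)+

text \<open>Sizes add under the product, and there are finitely many classes up to a given size.
  Finiteness matters because a \<open>sum\<close> over an infinite set would be 0 by
  convention.\<close>

lemma finite_factorizations:
  "finite {(b, c). b \<in> iso_classes h \<and> c \<in> iso_classes h \<and> class_prod h b c = a}"
proof (rule finite_subset)
  show "{(b, c). b \<in> iso_classes h \<and> c \<in> iso_classes h \<and> class_prod h b c = a}
      \<subseteq> {b \<in> iso_classes h. fst b \<le> fst a} \<times> {c \<in> iso_classes h. fst c \<le> fst a}"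
    by auto
qed (intro finite_cartesian_product finite_iso_classes_bounded)

text \<open>By \<open>star_restr\<close> the trace pair (S, T) of an occurrence of \<open>A\<close>
  has classes with product \<open>A\<close>. Sorting the pairs by these two classes leaves a full
  rectangle over each factorization, because S and T are then chosen independently.\<close>

lemma pattern_fun_class_prod:
  assumes A: "A \<in> iso_classes h" and x: "x \<in> iso_classes h" and y: "y \<in> iso_classes h"
  shows "pattern_fun h A (class_prod h x y)
    = (\<Sum>(b, c) | b \<in> iso_classes h \<and> c \<in> iso_classes h \<and> class_prod h b c = A.
        pattern_fun h b x * pattern_fun h c y)"
proof -
  obtain I u J v where I: "finite I" "u \<in> obj h I" "x = cls I u"
    and J: "finite J" "v \<in> obj h J" "y = cls J v" and IJ: "I \<inter> J = {}"
    by (rule disjoint_copies[OF x y x])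
  let ?P = "{(b, c). b \<in> iso_classes h \<and> c \<in> iso_classes h \<and> class_prod h b c = A}"
  define k l where "k S = cls S (restr h I S u)" and "l T = cls T (restr h J T v)" for S T
  let ?w = "star h I J u v"
  let ?X = "{(S, T). S \<subseteq> I \<and> T \<subseteq> J \<and> class_prod h (k S) (l T) = A}"
  have k: "k S \<in> iso_classes h" if "S \<subseteq> I" for S
    unfolding k_def using that I finite_subset[OF that I(1)] by (auto intro: cls_in_iso_classes restr_closed)
  have l: "l T \<in> iso_classes h" if "T \<subseteq> J" for T
    unfolding l_def using that J finite_subset[OF that J(1)] by (auto intro: cls_in_iso_classes restr_closed)
  have kl: "cls (S \<union> T) (restr h (I \<union> J) (S \<union> T) ?w) = class_prod h (k S) (l T)"
    if "S \<subseteq> I" "T \<subseteq> J" for S T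
    unfolding k_def l_def using that I J IJ finite_subset[OF that(1) I(1)] finite_subset[OF that(2) J(1)]
    by (subst class_prod_cls) (auto simp: star_restr intro: restr_closed)
  have "bij_betw (\<lambda>(S, T). S \<union> T) ?X {K. K \<subseteq> I \<union> J \<and> cls K (restr h (I \<union> J) K ?w) = A}"
  proof (rule bij_betw_byWitness[where f' = "\<lambda>K. (K \<inter> I, K \<inter> J)"])
    have *: "K = (K \<inter> I) \<union> (K \<inter> J)" if "K \<subseteq> I \<union> J" for K using that by auto
    show "(\<lambda>K. (K \<inter> I, K \<inter> J)) ` {K. K \<subseteq> I \<union> J \<and> cls K (restr h (I \<union> J) K ?w) = A} \<subseteq> ?X"
    proof clarsimp
      fix K assume "K \<subseteq> I \<union> J"
      from *[OF this] kl[of "K \<inter> I" "K \<inter> J"]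
      show "class_prod h (k (K \<inter> I)) (l (K \<inter> J)) = cls K (restr h (I \<union> J) K ?w)" by simp
    qed
  qed (use IJ kl in auto)
  then have KX: "card {K. K \<subseteq> I \<union> J \<and> cls K (restr h (I \<union> J) K ?w) = A} = card ?X"
    by (simp add: bij_betw_same_card)
  have fX: "finite ?X"
    by (rule finite_subset[of _ "Pow I \<times> Pow J"]) (use I J in auto)
  have "(\<lambda>w. (k (fst w), l (snd w))) ` ?X \<subseteq> ?P"
  proof (rule image_subsetI)
    fix w assume "w \<in> ?X"
    then show "(k (fst w), l (snd w)) \<in> ?P" by (cases w) (simp add: k l)
  qed
  from sum.group[OF fX finite_factorizations this, of "\<lambda>_. 1::nat"]
  have "card ?X = (\<Sum>q\<in>?P. card {w \<in> ?X. (k (fst w), l (snd w)) = q})"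
    by (simp only: card_eq_sum)
  also have "\<dots> = (\<Sum>(b, c)\<in>?P. card {S. S \<subseteq> I \<and> k S = b} * card {T. T \<subseteq> J \<and> l T = c})"
  proof (intro sum.cong refl)
    fix q assume "q \<in> ?P"
    then obtain b c where q: "q = (b, c)" and bc: "class_prod h b c = A" by auto
    have "(S \<subseteq> I \<and> T \<subseteq> J \<and> class_prod h (k S) (l T) = A) \<and> k S = b \<and> l T = c \<longleftrightarrow>
        (S \<subseteq> I \<and> k S = b) \<and> T \<subseteq> J \<and> l T = c" for S T
      using bc by blast
    then have "{w \<in> ?X. (k (fst w), l (snd w)) = (b, c)}
        = {S. S \<subseteq> I \<and> k S = b} \<times> {T. T \<subseteq> J \<and> l T = c}"
      by (simp add: set_eq_iff)
    then show "card {w \<in> ?X. (k (fst w), l (snd w)) = q}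
        = (case q of (b, c) \<Rightarrow> card {S. S \<subseteq> I \<and> k S = b} * card {T. T \<subseteq> J \<and> l T = c})"
      by (simp add: q card_cartesian_product)
  qed
  finally have "card ?X = (\<Sum>(b, c)\<in>?P. card {S. S \<subseteq> I \<and> k S = b} * card {T. T \<subseteq> J \<and> l T = c})" .
  then have "of_nat (card {K. K \<subseteq> I \<union> J \<and> cls K (restr h (I \<union> J) K ?w) = A})
      = (\<Sum>(b, c)\<in>?P. of_nat (card {S. S \<subseteq> I \<and> k S = b}) * of_nat (card {T. T \<subseteq> J \<and> l T = c}) :: rat)"
    by (simp add: KX case_prod_unfold)
  also have "\<dots> = (\<Sum>(b, c)\<in>?P. pattern_fun h b x * pattern_fun h c y)"
    using I J by (intro sum.cong refl) (auto simp: pattern_fun_cls k_def l_def)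
  finally show ?thesis
    using A I J IJ by (simp add: class_prod_cls pattern_fun_cls star_closed)
qed

section \<open>The bialgebra structure\<close>

text \<open>The cutoff is there because members of the tensor square vanish outside pairs of
  isomorphism classes, whereas \<open>class_prod\<close> has no meaning at such arguments.\<close>

definition comul ::
  "('a iso_class \<Rightarrow> rat) \<Rightarrow> 'a iso_class \<times> 'a iso_class \<Rightarrow> rat" where
  "comul f = (\<lambda>(x, y). if x \<in> iso_classes h \<and> y \<in> iso_classes h then f (class_prod h x y) else 0)"

lemma linear_comul: "linear_on V fscale comul"
  by (auto simp: linear_on_def comul_def fscale_def fun_eq_iff)

lemma comul_pattern_fun:
  assumes "a \<in> iso_classes h"
  shows "comul (pattern_fun h a) =
    (\<Sum>(b, c) | b \<in> iso_classes h \<and> c \<in> iso_classes h \<and> class_prod h b c = a.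
       pattern_fun h b \<otimes>\<^sub>f pattern_fun h c)"
proof
  fix p :: "'a iso_class \<times> 'a iso_class"
  obtain x y where p: "p = (x, y)" by (cases p)
  show "comul (pattern_fun h a) p =
    (\<Sum>(b, c) | b \<in> iso_classes h \<and> c \<in> iso_classes h \<and> class_prod h b c = a.
       pattern_fun h b \<otimes>\<^sub>f pattern_fun h c) p"
    using pattern_fun_class_prod[OF assms, of x y]
    by (auto simp: p comul_def sum_fun_apply tens_def case_prod_unfold pattern_fun_off)
qed

lemma pattern_fun_one_class:
  assumes "a \<in> iso_classes h"
  shows "pattern_fun h a one_class = (if a = one_class then 1 else 0)"
proof -
  have "restr h {} {} (unit_obj h) = unit_obj h"
    using act_id[OF _ unit_closed] by (simp add: restr_def)
  then have "{S. S \<subseteq> {} \<and> cls S (restr h {} S (unit_obj h)) = a} = (if a = one_class then {{}} else {})"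
    by (auto simp: one_class_eq)
  moreover have "pattern_fun h a one_class
      = of_nat (card {S. S \<subseteq> {} \<and> cls S (restr h {} S (unit_obj h)) = a})"
    using pattern_fun_cls[OF assms, of "{}" "unit_obj h"] unit_closed by (simp add: one_class_eq)
  ultimately show ?thesis by simp
qed

lemma pattern_algebra_linear_eq:
  assumes "linear_on (pattern_algebra h) s L" "linear_on (pattern_algebra h) s L'"
    and "\<And>a. a \<in> iso_classes h \<Longrightarrow> L (pattern_fun h a) = L' (pattern_fun h a)"
    and "f \<in> pattern_algebra h"
  shows "L f = L' f"
  by (rule linear_on_span_eq[OF assms(1,2)[unfolded pattern_algebra_def] _
        assms(4)[unfolded pattern_algebra_def]])
    (use assms(3) in auto)

lemma pattern_algebra_linear_mem:
  assumes "linear_on (pattern_algebra h) fscale L" "fun_space.subspace U"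
    and "\<And>a. a \<in> iso_classes h \<Longrightarrow> L (pattern_fun h a) \<in> U"
    and "f \<in> pattern_algebra h"
  shows "L f \<in> U"
  by (rule linear_on_span_mem[OF assms(1)[unfolded pattern_algebra_def] assms(2) _
        assms(4)[unfolded pattern_algebra_def]])
    (use assms(3) in auto)

lemma pattern_algebra_off:
  assumes "f \<in> pattern_algebra h" "x \<notin> iso_classes h"
  shows "f x = 0"
proof -
  have "f \<in> {f. f x = 0}"
    \<comment> \<open>With the identity as linear map this is span induction: the functions
      vanishing at \<open>x\<close> form a subspace containing the generators.\<close>
    by (rule pattern_algebra_linear_mem[of "\<lambda>f. f", OF _ _ _ assms(1)])
      (auto simp: linear_on_def fun_space.subspace_def fscale_def pattern_fun_off assms(2))
  then show ?thesis by simp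
qed

lemma is_coproduct_comul: "is_coproduct h comul"
  by (simp add: is_coproduct_def linear_comul comul_pattern_fun)

lemma is_counit_eval: "is_counit h (\<lambda>f. f one_class)"
  by (simp add: is_counit_def linear_on_def fscale_def pattern_fun_one_class)

lemma is_coproduct_unique:
  assumes "is_coproduct h \<Delta>" "f \<in> pattern_algebra h"
  shows "\<Delta> f = comul f"
  using assms is_coproduct_comul unfolding is_coproduct_def
  by (intro pattern_algebra_linear_eq[of fscale \<Delta> comul f]) auto

lemma is_counit_unique:
  assumes "is_counit h \<epsilon>" "f \<in> pattern_algebra h"
  shows "\<epsilon> f = f one_class"
  using assms is_counit_eval unfolding is_counit_def
  by (intro pattern_algebra_linear_eq[of "(*)" \<epsilon> "\<lambda>f. f one_class" f]) auto

lemma comul_mem: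
  assumes "f \<in> pattern_algebra h"
  shows "comul f \<in> tensor (pattern_algebra h) (pattern_algebra h)"
proof (rule pattern_algebra_linear_mem[OF linear_comul subspace_tensor _ assms])
  fix a assume "a \<in> iso_classes h"
  then show "comul (pattern_fun h a) \<in> tensor (pattern_algebra h) (pattern_algebra h)"
    unfolding comul_pattern_fun[OF \<open>a \<in> iso_classes h\<close>]
    by (intro fun_space.subspace_sum subspace_tensor) (auto intro: tens_mem pattern_fun_mem)
qed

lemma coalgebra_pattern_algebra:
  assumes \<Delta>: "is_coproduct h \<Delta>" and \<epsilon>: "is_counit h \<epsilon>"
  shows "coalgebra (pattern_algebra h) \<Delta> \<epsilon>"
  unfolding coalgebra_def
proof (intro conjI ballI)
  let ?A = "pattern_algebra h"
  note A = subspace_pattern_algebra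
  show "linear_on ?A fscale \<Delta>" "linear_on ?A (*) \<epsilon>"
    using \<Delta> \<epsilon> by (auto simp: is_coproduct_def is_counit_def)
  note lin = this
  fix f assume f: "f \<in> ?A"
  let ?t = "comul f"
  note \<Delta>f = is_coproduct_unique[OF \<Delta> f] and t = comul_mem[OF f]
  show "\<Delta> f \<in> tensor ?A ?A" using t \<Delta>f by simp
  \<comment> \<open>The sections of \<open>comul f\<close> lie in the pattern algebra, the only
    place where \<open>\<Delta>\<close> is known.\<close>
  have left: "\<Delta> (\<lambda>x. ?t (x, y)) = comul (\<lambda>x. ?t (x, y))"
    and right: "\<Delta> (\<lambda>x. ?t (y, x)) = comul (\<lambda>x. ?t (y, x))" for y
    using t by (intro is_coproduct_unique[OF \<Delta>] tensor_section_left tensor_section_right A; simp)+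
  \<comment> \<open>On isomorphism classes both sides send (x, (y, z)) to the value of
    \<open>f\<close> at the product of x, y and z.\<close>
  show "tensor_assoc (tensor_map ?A ?A \<Delta> id (\<Delta> f)) = tensor_map ?A ?A id \<Delta> (\<Delta> f)"
    unfolding \<Delta>f tensor_map_id_right[OF A A lin(1) t] tensor_map_id_left[OF A A lin(1) t] left right
    by (auto simp: tensor_assoc_def comul_def fun_eq_iff class_prod_mem class_prod_assoc)
  have "tensor_lift ?A ?A (\<lambda>g. fscale (\<epsilon> g)) ?t = (\<lambda>y. ?t (one_class, y))"
    using is_counit_unique[OF \<epsilon>]
    by (intro tensor_lift_eq[OF A A _ _ t]) (auto simp: linear_on_def fscale_def tens_def fun_eq_iff)
  also have "\<dots> = f"
    using pattern_algebra_off[OF f] by (auto simp: comul_def fun_eq_iff one_class_mem class_prod_one)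
  finally show "tensor_lift ?A ?A (\<lambda>g k. fscale (\<epsilon> g) k) (\<Delta> f) = f" by (simp add: \<Delta>f)
  have "tensor_lift ?A ?A (\<lambda>g k. fscale (\<epsilon> k) g) ?t = (\<lambda>x. ?t (x, one_class))"
    using is_counit_unique[OF \<epsilon>]
    by (intro tensor_lift_eq[OF A A _ _ t]) (auto simp: linear_on_def fscale_def tens_def fun_eq_iff)
  also have "\<dots> = f"
    using pattern_algebra_off[OF f] by (auto simp: comul_def fun_eq_iff one_class_mem class_prod_one)
  finally show "tensor_lift ?A ?A (\<lambda>g k. fscale (\<epsilon> k) g) (\<Delta> f) = f" by (simp add: \<Delta>f)
qed (rule subspace_pattern_algebra)

lemma pattern_algebra_mult:
  assumes "f \<in> pattern_algebra h" "g \<in> pattern_algebra h"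
  shows "f * g \<in> pattern_algebra h"
proof -
  have lin: "linear_on V fscale (\<lambda>f. f * g)" "linear_on V fscale ((*) g)"
    for V and g :: "'a iso_class \<Rightarrow> rat"
    by (auto simp: linear_on_def fscale_def fun_eq_iff algebra_simps)
  have "pattern_fun h a * g \<in> pattern_algebra h" if "a \<in> iso_classes h" for a
    by (rule pattern_algebra_linear_mem[OF lin(2) subspace_pattern_algebra _ assms(2)])
      (rule pattern_fun_mult_mem[OF that])
  then show ?thesis
    by (rule pattern_algebra_linear_mem[OF lin(1) subspace_pattern_algebra _ assms(1)])
qed

text \<open>Every \<open>x\<close> has exactly one occurrence of size 0, its restriction to the
  empty set. Without connectedness this restriction varies with \<open>x\<close>, so the unit is a
  sum over all classes of size 0.\<close>

lemma pattern_one_eq: "pattern_one h = (\<Sum>c | c \<in> iso_classes h \<and> fst c \<le> 0. pattern_fun h c)"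
proof
  fix x
  show "pattern_one h x = (\<Sum>c | c \<in> iso_classes h \<and> fst c \<le> 0. pattern_fun h c) x"
  proof (cases "x \<in> iso_classes h")
    case True
    note r = iso_class_rep[OF True]
    let ?e = "cls {} (restr h {1..fst x} {} (rep x))"
    have e: "?e \<in> {c \<in> iso_classes h. fst c \<le> 0}"
      using r by (auto intro!: cls_in_iso_classes restr_closed)
    have "pattern_fun h c x = (if c = ?e then 1 else 0)" if "c \<in> iso_classes h" "fst c \<le> 0" for c
    proof -
      have "S = {}" if "S \<subseteq> {1..fst x}" "cls S (restr h {1..fst x} S (rep x)) = c" for S
      proof -
        have "card S = fst c" using arg_cong[OF that(2), of fst] by simp
        then show "S = {}" using \<open>fst c \<le> 0\<close> finite_subset[OF that(1)] by simp
      qed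
      then have "{S. S \<subseteq> {1..fst x} \<and> cls S (restr h {1..fst x} S (rep x)) = c}
          = (if c = ?e then {{}} else {})" by (auto simp del: One_nat_def)
      then show ?thesis using pattern_fun_eq[OF that(1) True] by simp
    qed
    then have "(\<Sum>c | c \<in> iso_classes h \<and> fst c \<le> 0. pattern_fun h c x)
        = (\<Sum>c | c \<in> iso_classes h \<and> fst c \<le> 0. if c = ?e then 1 else 0)"
      by (intro sum.cong) auto
    also have "\<dots> = 1" using e finite_iso_classes_bounded[of 0] by (subst sum.delta) auto
    finally show ?thesis using True by (simp add: sum_fun_apply pattern_one_def)
  qed (simp add: sum_fun_apply pattern_one_def pattern_fun_off)
qed

lemma pattern_one_mem: "pattern_one h \<in> pattern_algebra h"
  unfolding pattern_one_eq
  by (intro fun_space.subspace_sum subspace_pattern_algebra pattern_fun_mem) auto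

lemma unital_algebra_pattern_algebra: "unital_algebra (pattern_algebra h) (*) (pattern_one h)"
  unfolding unital_algebra_def
proof (intro conjI ballI)
  show "bilinear_on (pattern_algebra h) (pattern_algebra h) fscale (*)"
    by (auto simp: bilinear_on_def linear_on_def fscale_def fun_eq_iff algebra_simps)
  fix f assume "f \<in> pattern_algebra h"
  then show "pattern_one h * f = f" "f * pattern_one h = f"
    using pattern_algebra_off by (auto simp: pattern_one_def fun_eq_iff indicator_def)
qed (auto simp: mult.assoc subspace_pattern_algebra pattern_algebra_mult pattern_one_mem)

lemma bialgebra_pattern_algebra:
  assumes \<Delta>: "is_coproduct h \<Delta>" and \<epsilon>: "is_counit h \<epsilon>"
  shows "bialgebra (pattern_algebra h) (*) (pattern_one h) \<Delta> \<epsilon>"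
proof -
  let ?A = "pattern_algebra h"
  have "\<Delta> (f * g) = tensor_mult ?A (*) (\<Delta> f) (\<Delta> g)" if "f \<in> ?A" "g \<in> ?A" for f g
  proof -
    \<comment> \<open>\<open>comul\<close> is composition with the monoid product, and composition
      respects pointwise multiplication.\<close>
    have "\<Delta> (f * g) = comul f * comul g"
      using that by (auto simp: is_coproduct_unique[OF \<Delta>] pattern_algebra_mult comul_def fun_eq_iff)
    then show ?thesis
      using that by (simp add: is_coproduct_unique[OF \<Delta>] tensor_mult_times subspace_pattern_algebra comul_mem)
  qed
  moreover have "\<Delta> (pattern_one h) = pattern_one h \<otimes>\<^sub>f pattern_one h"
    unfolding is_coproduct_unique[OF \<Delta> pattern_one_mem]
    by (auto simp: comul_def fun_eq_iff tens_def pattern_one_def indicator_def class_prod_mem)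
  moreover have "\<epsilon> (f * g) = \<epsilon> f * \<epsilon> g" if "f \<in> ?A" "g \<in> ?A" for f g
    using that by (simp add: is_counit_unique[OF \<epsilon>] pattern_algebra_mult)
  moreover have "\<epsilon> (pattern_one h) = 1"
    by (simp add: is_counit_unique[OF \<epsilon>] pattern_one_mem) (simp add: pattern_one_def one_class_mem)
  ultimately show ?thesis
    using unital_algebra_pattern_algebra coalgebra_pattern_algebra[OF assms]
    unfolding bialgebra_def by blast
qed

section \<open>The antipode\<close>

text \<open>\<open>coinv\<close> inverts \<open>R\<^sub>x = rtrans x\<close> by the geometric series of \<open>rdiff x = R\<^sub>x - id\<close>, which is
  locally nilpotent when \<open>h\<close> is connected. The left translations commute with \<open>R\<^sub>x\<close> and agree with
  it at the unit, hence \<open>coinv\<close> is an antipode on both sides.\<close>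

definition rtrans :: "'a iso_class \<Rightarrow> ('a iso_class \<Rightarrow> rat) \<Rightarrow> 'a iso_class \<Rightarrow> rat" where
  "rtrans x f = (\<lambda>y. if y \<in> iso_classes h then f (class_prod h y x) else 0)"

definition ltrans :: "'a iso_class \<Rightarrow> ('a iso_class \<Rightarrow> rat) \<Rightarrow> 'a iso_class \<Rightarrow> rat" where
  "ltrans x f = (\<lambda>y. if y \<in> iso_classes h then f (class_prod h x y) else 0)"

definition rdiff :: "'a iso_class \<Rightarrow> ('a iso_class \<Rightarrow> rat) \<Rightarrow> 'a iso_class \<Rightarrow> rat" where
  "rdiff x f = rtrans x f - f"

definition coinv :: "('a iso_class \<Rightarrow> rat) \<Rightarrow> 'a iso_class \<Rightarrow> rat" where
  "coinv f x = (if x \<in> iso_classes h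
     then \<Sum>k | (rdiff x ^^ k) f \<noteq> 0. (- 1) ^ k * (rdiff x ^^ k) f one_class else 0)"

lemma rdiff_add: "rdiff x (f + g) = rdiff x f + rdiff x g"
  and rdiff_scale: "rdiff x (fscale c f) = fscale c (rdiff x f)"
  by (auto simp: rdiff_def rtrans_def fscale_def fun_eq_iff algebra_simps)

lemma rdiff_pow_add: "(rdiff x ^^ k) (f + g) = (rdiff x ^^ k) f + (rdiff x ^^ k) g"
  by (induction k) (simp_all only: funpow.simps id_apply comp_apply rdiff_add)

lemma rdiff_pow_scale: "(rdiff x ^^ k) (fscale c f) = fscale c ((rdiff x ^^ k) f)"
  by (induction k) (simp_all only: funpow.simps id_apply comp_apply rdiff_scale)

lemma rdiff_pow_zero [simp]: "(rdiff x ^^ k) 0 = 0"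
  using rdiff_pow_scale[of k x 0 0] by (simp add: fscale_def zero_fun_def)

lemma rdiff_pow_sum: "(rdiff x ^^ k) (sum F P) = (\<Sum>p\<in>P. (rdiff x ^^ k) (F p))"
  by (induction P rule: infinite_finite_induct)
    (simp_all only: sum.infinite sum.empty sum.insert rdiff_pow_zero rdiff_pow_add simp_thms)

lemma rdiff_ltrans:
  assumes "x \<in> iso_classes h" "z \<in> iso_classes h"
  shows "(rdiff x ^^ k) (ltrans z f) = ltrans z ((rdiff x ^^ k) f)"
proof (induction k)
  case (Suc k)
  have "rdiff x (ltrans z g) = ltrans z (rdiff x g)" for g
    using assms
    by (auto simp: rdiff_def rtrans_def ltrans_def fun_eq_iff class_prod_mem class_prod_assoc)
  then show ?case by (simp add: Suc)
qed simp

text \<open>Once a power of \<open>rdiff x\<close> kills \<open>f\<close>, all higher ones do. Any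
  such exponent may therefore bound the series, which allows series of different functions to share
  one range.\<close>

lemma coinv_eq:
  assumes "x \<in> iso_classes h" "(rdiff x ^^ n) f = 0"
  shows "coinv f x = (\<Sum>k<n. (- 1) ^ k * (rdiff x ^^ k) f one_class)"
proof -
  have "(rdiff x ^^ k) f = 0" if "n \<le> k" for k
  proof -
    have "(rdiff x ^^ k) f = (rdiff x ^^ (k - n)) ((rdiff x ^^ n) f)"
      using that by (simp flip: funpow_add comp_apply[of "rdiff x ^^ (k - n)"])
    then show ?thesis by (simp add: assms(2))
  qed
  then have "{k. (rdiff x ^^ k) f \<noteq> 0} \<subseteq> {..<n}" by (auto simp: not_less[symmetric])
  then show ?thesis
    using assms(1) unfolding coinv_def by (auto intro!: sum.mono_neutral_left)
qed

text \<open>With \<open>u k\<close> the value at the unit of the k-th power of N =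
  \<open>rdiff x\<close> applied to \<open>f\<close>, this is the inversion of id + N by the
  geometric series; the last term is the remainder, killed by nilpotency.\<close>

lemma sum_alternating_telescope:
  fixes u :: "nat \<Rightarrow> 'r::comm_ring_1"
  shows "(\<Sum>k<n. (- 1) ^ k * (u k + u (Suc k))) = u 0 - (- 1) ^ n * u n"
  by (induction n) (simp_all add: algebra_simps)

lemma rtrans_eq: "rtrans x f = f + rdiff x f"
  by (simp add: rdiff_def)

lemma rdiff_pow_rtrans: "(rdiff x ^^ k) (rtrans x f) = rtrans x ((rdiff x ^^ k) f)"
  unfolding rtrans_eq rdiff_pow_add by (simp only: funpow_swap1)

lemma rtrans_zero: "rtrans x 0 = 0"
  by (simp add: rtrans_def fun_eq_iff)

lemma coinv_rtrans:
  assumes x: "x \<in> iso_classes h" and n: "(rdiff x ^^ n) f = 0"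
  shows "coinv (rtrans x f) x = f one_class"
proof -
  have N: "(rdiff x ^^ k) (rtrans x f) = (rdiff x ^^ k) f + (rdiff x ^^ Suc k) f" for k
    by (simp only: rdiff_pow_rtrans funpow.simps comp_apply) (rule rtrans_eq)
  have "(rdiff x ^^ n) (rtrans x f) = 0"
    by (simp only: rdiff_pow_rtrans n rtrans_zero)
  from coinv_eq[OF x this] show ?thesis
    using sum_alternating_telescope[of "\<lambda>k. (rdiff x ^^ k) f one_class" n]
    by (simp only: N plus_fun_apply n) simp
qed

text \<open>The series for the left and the right translate agree term by term: translation commutes
  with \<open>rdiff x\<close> on either side, and both translates by \<open>x\<close> of the same
  function take its value at \<open>x\<close> when evaluated at the unit.\<close>

lemma coinv_ltrans:
  assumes x: "x \<in> iso_classes h" and n: "(rdiff x ^^ n) f = 0"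
  shows "coinv (ltrans x f) x = f one_class"
proof -
  have "(rdiff x ^^ k) (ltrans x f) one_class = (rdiff x ^^ k) (rtrans x f) one_class" for k
    using x unfolding rdiff_pow_rtrans rdiff_ltrans[OF x x]
    by (simp add: ltrans_def rtrans_def one_class_mem class_prod_one)
  moreover have "(rdiff x ^^ n) (ltrans x f) = 0"
    unfolding rdiff_ltrans[OF x x] n by (simp add: ltrans_def fun_eq_iff)
  moreover have "(rdiff x ^^ n) (rtrans x f) = 0"
    by (simp only: rdiff_pow_rtrans n rtrans_zero)
  ultimately have "coinv (ltrans x f) x = coinv (rtrans x f) x"
    using coinv_eq[OF x] by simp
  then show ?thesis using coinv_rtrans[OF x n] by simp
qed

end

section \<open>The connected case: local nilpotence and the antipode\<close>

locale connected_associative_presheaf = associative_presheaf +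
  assumes connected: "card (obj h {}) = 1"
begin

lemma class_of_size_0:
  assumes "c \<in> iso_classes h" "fst c = 0"
  shows "c = one_class"
proof -
  have "rep c \<in> obj h {}" "cls {} (rep c) = c"
    using iso_class_rep[OF assms(1)] assms(2) by auto
  moreover have "rep c = unit_obj h"
    using connected unit_closed \<open>rep c \<in> obj h {}\<close> by (metis card_1_singletonE singletonD)
  ultimately show ?thesis by (simp add: one_class_eq)
qed

lemma pattern_fun_one:
  assumes "x \<in> iso_classes h"
  shows "pattern_fun h one_class x = 1"
proof -
  have "{c \<in> iso_classes h. fst c \<le> 0} = {one_class}"
  proof (intro equalityI subsetI)
    fix c assume "c \<in> {one_class}"
    then show "c \<in> {c \<in> iso_classes h. fst c \<le> 0}"
      using one_class_mem by (simp add: class_of_def)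
  qed (use class_of_size_0 in simp)
  then have "pattern_one h x = pattern_fun h one_class x"
    unfolding pattern_one_eq by simp
  then show ?thesis using assms by (simp add: pattern_one_def)
qed

text \<open>The only factorization of \<open>a\<close> with second factor \<open>one_class\<close>
  is the trivial one. By \<open>pattern_fun_one\<close> it contributes exactly the
  \<open>pattern_fun h a\<close> that \<open>rdiff\<close> subtracts.\<close>

lemma rdiff_pattern_fun:
  assumes x: "x \<in> iso_classes h" and a: "a \<in> iso_classes h"
  shows "rdiff x (pattern_fun h a) =
    (\<Sum>(b, c) | b \<in> iso_classes h \<and> c \<in> iso_classes h \<and> class_prod h b c = a \<and> c \<noteq> one_class.
       fscale (pattern_fun h c x) (pattern_fun h b))"
proof
  fix y
  let ?P = "{(b, c). b \<in> iso_classes h \<and> c \<in> iso_classes h \<and> class_prod h b c = a}"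
  let ?Q = "{(b, c). b \<in> iso_classes h \<and> c \<in> iso_classes h \<and> class_prod h b c = a \<and> c \<noteq> one_class}"
  have "rdiff x (pattern_fun h a) y = (\<Sum>(b, c)\<in>?Q. pattern_fun h c x * pattern_fun h b y)"
  proof (cases "y \<in> iso_classes h")
    case y: True
    have "class_prod h b c = a \<and> c = one_class \<longleftrightarrow> b = a \<and> c = one_class"
      if "b \<in> iso_classes h" for b c
      using class_prod_one[OF that] class_prod_one[OF a] by metis
    then have P: "?P = insert (a, one_class) ?Q"
      using a one_class_mem by blast
    have "finite ?Q" using finite_factorizations[of a] unfolding P by simp
    have "pattern_fun h a (class_prod h y x) = (\<Sum>(b, c)\<in>?P. pattern_fun h b y * pattern_fun h c x)"
      by (rule pattern_fun_class_prod[OF a y x])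
    also have "\<dots> = pattern_fun h a y + (\<Sum>(b, c)\<in>?Q. pattern_fun h b y * pattern_fun h c x)"
      unfolding P using \<open>finite ?Q\<close> by (subst sum.insert) (auto simp: pattern_fun_one x)
    finally show ?thesis using y by (simp add: rdiff_def rtrans_def mult.commute)
  qed (simp add: rdiff_def rtrans_def pattern_fun_off)
  also have "\<dots> = (\<Sum>(b, c)\<in>?Q. fscale (pattern_fun h c x) (pattern_fun h b)) y"
    by (simp add: sum_fun_apply fscale_def case_prod_unfold)
  finally show "rdiff x (pattern_fun h a) y
      = (\<Sum>(b, c)\<in>?Q. fscale (pattern_fun h c x) (pattern_fun h b)) y" .
qed

lemma rdiff_pow_Suc_pattern_fun:
  assumes "x \<in> iso_classes h" "a \<in> iso_classes h"
  shows "(rdiff x ^^ Suc k) (pattern_fun h a) =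
    (\<Sum>(b, c) | b \<in> iso_classes h \<and> c \<in> iso_classes h \<and> class_prod h b c = a \<and> c \<noteq> one_class.
       fscale (pattern_fun h c x) ((rdiff x ^^ k) (pattern_fun h b)))"
  by (simp only: funpow_Suc_right comp_apply rdiff_pattern_fun[OF assms] rdiff_pow_sum
      case_prod_unfold rdiff_pow_scale)

text \<open>A second factor other than \<open>one_class\<close> has positive size, so each
  application of \<open>rdiff x\<close> lowers the size of the pattern. At size 0 the sum is already
  empty, hence the strict bound.\<close>

lemma rdiff_pow_pattern_fun:
  assumes "x \<in> iso_classes h" "a \<in> iso_classes h" "fst a < n"
  shows "(rdiff x ^^ n) (pattern_fun h a) = 0"
  using assms(2,3)
proof (induction n arbitrary: a)
  case (Suc n)
  let ?Q = "{(b, c). b \<in> iso_classes h \<and> c \<in> iso_classes h \<and> class_prod h b c = a \<and> c \<noteq> one_class}"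
  have "fscale (pattern_fun h c x) ((rdiff x ^^ n) (pattern_fun h b)) = 0" if "(b, c) \<in> ?Q" for b c
  proof -
    have "fst a = fst b + fst c" "fst c \<noteq> 0" using that class_of_size_0[of c] by auto
    then have "(rdiff x ^^ n) (pattern_fun h b) = 0" using Suc that by auto
    then show ?thesis by (simp add: fscale_def fun_eq_iff)
  qed
  then show ?case
    unfolding rdiff_pow_Suc_pattern_fun[OF assms(1) Suc.prems(1)] by (intro sum.neutral) auto
qed simp

lemma rdiff_nilpotent:
  assumes "f \<in> pattern_algebra h"
  obtains n where "\<And>x. x \<in> iso_classes h \<Longrightarrow> (rdiff x ^^ n) f = 0"
proof -
  \<comment> \<open>Asking for all larger exponents makes \<open>?U\<close> closed under sums via a
    maximum. The exponent is uniform in \<open>x\<close>, so that \<open>coinv_mem\<close> can write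
    \<open>coinv f\<close> as one finite sum of functions.\<close>
  let ?U = "{f. \<exists>n. \<forall>m\<ge>n. \<forall>x\<in>iso_classes h. (rdiff x ^^ m) f = 0}"
  have "f \<in> ?U"
  proof (rule pattern_algebra_linear_mem[of "\<lambda>f. f", OF _ _ _ assms])
    show "fun_space.subspace ?U"
      unfolding fun_space.subspace_def
    proof (intro conjI ballI allI)
      fix f g assume "f \<in> ?U" "g \<in> ?U"
      then obtain n n' where "\<forall>m\<ge>n. \<forall>x\<in>iso_classes h. (rdiff x ^^ m) f = 0"
        "\<forall>m\<ge>n'. \<forall>x\<in>iso_classes h. (rdiff x ^^ m) g = 0" by auto
      then show "f + g \<in> ?U" by (auto simp: rdiff_pow_add intro!: exI[of _ "max n n'"])
    next
      fix c f assume "f \<in> ?U"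
      moreover have "fscale c 0 = (0 :: 'a iso_class \<Rightarrow> rat)" by (auto simp: fscale_def)
      ultimately show "fscale c f \<in> ?U" by (auto simp: rdiff_pow_scale)
    qed simp
    show "pattern_fun h a \<in> ?U" if "a \<in> iso_classes h" for a
      using that by (auto simp: rdiff_pow_pattern_fun intro!: exI[of _ "Suc (fst a)"])
  qed (simp add: linear_on_def)
  then show ?thesis using that by blast
qed

lemma linear_coinv: "linear_on (pattern_algebra h) fscale coinv"
  unfolding linear_on_def
proof (intro conjI ballI allI)
  fix f g assume f: "f \<in> pattern_algebra h" and g: "g \<in> pattern_algebra h"
  have fg: "f + g \<in> pattern_algebra h"
    using f g subspace_pattern_algebra by (auto simp: fun_space.subspace_def)
  show "coinv (f + g) = coinv f + coinv g"
  proof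
    fix x
    show "coinv (f + g) x = (coinv f + coinv g) x"
    proof (cases "x \<in> iso_classes h")
      case x: True
      obtain m where m: "(rdiff x ^^ m) f = 0" using rdiff_nilpotent[OF f] x by metis
      obtain n where n: "(rdiff x ^^ n) g = 0" using rdiff_nilpotent[OF g] x by metis
      have f0: "(rdiff x ^^ (n + m)) f = 0" using m by (simp add: funpow_add)
      have g0: "(rdiff x ^^ (n + m)) g = 0"
        using n by (subst add.commute) (simp add: funpow_add)
      have "(rdiff x ^^ (n + m)) (f + g) = 0" by (simp add: rdiff_pow_add f0 g0)
      from coinv_eq[OF x this] coinv_eq[OF x f0] coinv_eq[OF x g0] show ?thesis
        by (simp add: rdiff_pow_add algebra_simps sum.distrib)
    qed (simp add: coinv_def)
  qed
next
  fix c f assume f: "f \<in> pattern_algebra h"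
  show "coinv (fscale c f) = fscale c (coinv f)"
  proof
    fix x
    show "coinv (fscale c f) x = fscale c (coinv f) x"
    proof (cases "x \<in> iso_classes h")
      case x: True
      obtain m where m: "(rdiff x ^^ m) f = 0" using rdiff_nilpotent[OF f] x by metis
      have "(rdiff x ^^ m) (fscale c f) = 0"
        unfolding rdiff_pow_scale m by (auto simp: fscale_def)
      then have "coinv (fscale c f) x = (\<Sum>k<m. (- 1) ^ k * (c * (rdiff x ^^ k) f one_class))"
        using coinv_eq[OF x] by (simp only: rdiff_pow_scale) (simp only: fscale_def)
      also have "\<dots> = fscale c (coinv f) x"
        by (simp add: fscale_def coinv_eq[OF x m] sum_distrib_left mult_ac)
      finally show ?thesis .
    qed (simp add: coinv_def fscale_def)
  qed
qed

text \<open>The operator itself varies with \<open>x\<close>, but only through the coefficients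
  \<open>pattern_fun h c x\<close> of its expansion. Unrolling the recursion gives products of
  pattern functions over factorizations into non-trivial classes, as in Takeuchi's formula for the
  antipode; closure under multiplication does the rest.\<close>

lemma rdiff_pow_one_class_mem:
  assumes "f \<in> pattern_algebra h"
  shows "(\<lambda>x. if x \<in> iso_classes h then (rdiff x ^^ k) f one_class else 0) \<in> pattern_algebra h"
  using assms
proof (induction k arbitrary: f)
  case 0
  have "(\<lambda>x. if x \<in> iso_classes h then f one_class else 0) = fscale (f one_class) (pattern_one h)"
    by (auto simp: fscale_def pattern_one_def)
  then show ?case
    using fun_space.subspace_scale[OF subspace_pattern_algebra pattern_one_mem, of "f one_class"]
    by (simp only: funpow.simps id_apply)
next
  case (Suc k)
  show ?case
  proof (rule pattern_algebra_linear_mem[OF _ subspace_pattern_algebra _ Suc.prems])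
    show "linear_on (pattern_algebra h) fscale
        (\<lambda>f x. if x \<in> iso_classes h then (rdiff x ^^ Suc k) f one_class else 0)"
      unfolding linear_on_def rdiff_pow_add rdiff_pow_scale by (auto simp: fscale_def)
    fix a assume a: "a \<in> iso_classes h"
    let ?Q = "{(b, c). b \<in> iso_classes h \<and> c \<in> iso_classes h \<and> class_prod h b c = a \<and> c \<noteq> one_class}"
    let ?T = "\<lambda>b x. if x \<in> iso_classes h then (rdiff x ^^ k) (pattern_fun h b) one_class else 0"
    have "(\<lambda>x. if x \<in> iso_classes h then (rdiff x ^^ Suc k) (pattern_fun h a) one_class else 0)
        = (\<Sum>(b, c)\<in>?Q. pattern_fun h c * ?T b)"
      by (auto simp: fun_eq_iff rdiff_pow_Suc_pattern_fun[OF _ a] sum_fun_apply fscale_def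
          case_prod_unfold simp del: funpow.simps)
    also have "\<dots> \<in> pattern_algebra h"
      using Suc.IH
      by (intro fun_space.subspace_sum subspace_pattern_algebra) (auto intro!: pattern_algebra_mult pattern_fun_mem)
    finally show "(\<lambda>x. if x \<in> iso_classes h then (rdiff x ^^ Suc k) (pattern_fun h a) one_class else 0)
      \<in> pattern_algebra h" .
  qed
qed

lemma coinv_mem:
  assumes "f \<in> pattern_algebra h"
  shows "coinv f \<in> pattern_algebra h"
proof -
  obtain n where n: "\<And>x. x \<in> iso_classes h \<Longrightarrow> (rdiff x ^^ n) f = 0"
    using rdiff_nilpotent[OF assms] by blast
  have "coinv f = (\<Sum>k<n. fscale ((- 1) ^ k)
      (\<lambda>x. if x \<in> iso_classes h then (rdiff x ^^ k) f one_class else 0))"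
  proof
    fix x
    show "coinv f x = (\<Sum>k<n. fscale ((- 1) ^ k)
      (\<lambda>x. if x \<in> iso_classes h then (rdiff x ^^ k) f one_class else 0)) x"
      by (cases "x \<in> iso_classes h")
        (simp_all add: coinv_eq[OF _ n] sum_fun_apply fscale_def, simp add: coinv_def)
  qed
  also have "\<dots> \<in> pattern_algebra h"
    by (intro fun_space.subspace_sum fun_space.subspace_scale subspace_pattern_algebra
        rdiff_pow_one_class_mem assms)
  finally show ?thesis .
qed

text \<open>With one variable fixed at x, \<open>comul f\<close> is \<open>rtrans x f\<close> or
  \<open>ltrans x f\<close>. Multiplication restricts to the diagonal, so \<open>coinv\<close> of
  that translate is evaluated at the same x, the case settled by \<open>coinv_rtrans\<close> and
  \<open>coinv_ltrans\<close>.\<close>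

lemma antipode_coinv:
  assumes \<Delta>: "is_coproduct h \<Delta>" and \<epsilon>: "is_counit h \<epsilon>"
  shows "antipode (pattern_algebra h) (*) (pattern_one h) \<Delta> \<epsilon> coinv"
  unfolding antipode_def
proof (intro conjI ballI)
  let ?A = "pattern_algebra h"
  note A = subspace_pattern_algebra
  fix f assume f: "f \<in> ?A"
  note \<Delta>f = is_coproduct_unique[OF \<Delta> f] and t = comul_mem[OF f]
  obtain n where n: "\<And>x. x \<in> iso_classes h \<Longrightarrow> (rdiff x ^^ n) f = 0"
    using rdiff_nilpotent[OF f] by blast
  have id: "linear_on ?A fscale id" by (simp add: linear_on_def)
  have off: "coinv g x = 0" if "x \<notin> iso_classes h" for g x using that by (simp add: coinv_def)
  have "tensor_lift ?A ?A (*) (tensor_map ?A ?A coinv id (comul f))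
      = (\<lambda>x. coinv (\<lambda>y. comul f (y, x)) x)"
    using tensor_map_mem[OF A A linear_coinv _ id _ t] coinv_mem
    by (subst tensor_lift_times[OF A]) (auto simp: tensor_map_id_right[OF A A linear_coinv t])
  also have "\<dots> = fscale (\<epsilon> f) (pattern_one h)"
  proof
    fix x
    show "coinv (\<lambda>y. comul f (y, x)) x = fscale (\<epsilon> f) (pattern_one h) x"
    proof (cases "x \<in> iso_classes h")
      case x: True
      then have "(\<lambda>y. comul f (y, x)) = rtrans x f" by (auto simp: comul_def rtrans_def)
      then show ?thesis
        using x coinv_rtrans[OF x n[OF x]] is_counit_unique[OF \<epsilon> f]
        by (simp add: fscale_def pattern_one_def)
    qed (simp add: off fscale_def pattern_one_def)
  qed
  finally show "tensor_lift ?A ?A (*) (tensor_map ?A ?A coinv id (\<Delta> f)) = fscale (\<epsilon> f) (pattern_one h)"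
    by (simp add: \<Delta>f)
  have "tensor_lift ?A ?A (*) (tensor_map ?A ?A id coinv (comul f))
      = (\<lambda>x. coinv (\<lambda>y. comul f (x, y)) x)"
    using tensor_map_mem[OF A A id _ linear_coinv _ t] coinv_mem
    by (subst tensor_lift_times[OF A]) (auto simp: tensor_map_id_left[OF A A linear_coinv t])
  also have "\<dots> = fscale (\<epsilon> f) (pattern_one h)"
  proof
    fix x
    show "coinv (\<lambda>y. comul f (x, y)) x = fscale (\<epsilon> f) (pattern_one h) x"
    proof (cases "x \<in> iso_classes h")
      case x: True
      then have "(\<lambda>y. comul f (x, y)) = ltrans x f" by (auto simp: comul_def ltrans_def)
      then show ?thesis
        using x coinv_ltrans[OF x n[OF x]] is_counit_unique[OF \<epsilon> f]
        by (simp add: fscale_def pattern_one_def)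
    qed (simp add: off fscale_def pattern_one_def)
  qed
  finally show "tensor_lift ?A ?A (*) (tensor_map ?A ?A id coinv (\<Delta> f)) = fscale (\<epsilon> f) (pattern_one h)"
    by (simp add: \<Delta>f)
qed (auto simp: linear_coinv coinv_mem)

lemma hopf_algebra_pattern_algebra:
  assumes "is_coproduct h \<Delta>" "is_counit h \<epsilon>"
  shows "hopf_algebra (pattern_algebra h) (*) (pattern_one h) \<Delta> \<epsilon>"
  using bialgebra_pattern_algebra[OF assms] antipode_coinv[OF assms]
  by (auto simp: hopf_algebra_def)

end

text \<open>The existence part keeps the universal part from being vacuous; quantifying over all
  \<Delta> and \<epsilon> adds no freedom on the pattern algebra, where both are determined.\<close>

theorem mainTheorem3:
  fixes h :: "'a assoc_presheaf"
  assumes "associative_presheaf h"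
  shows "(\<exists>\<Delta> \<epsilon>. is_coproduct h \<Delta> \<and> is_counit h \<epsilon>) \<and>
    (\<forall>\<Delta> \<epsilon>. is_coproduct h \<Delta> \<longrightarrow> is_counit h \<epsilon> \<longrightarrow>
       coalgebra (pattern_algebra h) \<Delta> \<epsilon> \<and>
       bialgebra (pattern_algebra h) (*) (pattern_one h) \<Delta> \<epsilon> \<and>
       (card (obj h {}) = 1 \<longrightarrow>
          hopf_algebra (pattern_algebra h) (*) (pattern_one h) \<Delta> \<epsilon>))"
proof -
  interpret associative_presheaf h by (rule assms)
  show ?thesis
  proof (intro conjI allI impI)
    show "\<exists>\<Delta> \<epsilon>. is_coproduct h \<Delta> \<and> is_counit h \<epsilon>"
      using is_coproduct_comul is_counit_eval by blast
    fix \<Delta> \<epsilon>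
    assume *: "is_coproduct h \<Delta>" "is_counit h \<epsilon>"
    show "coalgebra (pattern_algebra h) \<Delta> \<epsilon>"
      using * by (rule coalgebra_pattern_algebra)
    show "bialgebra (pattern_algebra h) (*) (pattern_one h) \<Delta> \<epsilon>"
      using * by (rule bialgebra_pattern_algebra)
    assume "card (obj h {}) = 1"
    then interpret connected_associative_presheaf h by unfold_locales
    show "hopf_algebra (pattern_algebra h) (*) (pattern_one h) \<Delta> \<epsilon>"
      using * by (rule hopf_algebra_pattern_algebra)
  qed
qed

end
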